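(* Consider the fixed stress split iterative scheme for small strain anisotropic poroelastoplasticity coupled with single phase flow, as defined in the context, at a fixed time step, and let the differences $\delta^{(k)}(\cdot)$ and $\delta^{(k)}_p(\cdot)$ of its iterates be as defined there. Then the fixed stress split scheme is a contraction map with contraction constant $\gamma=\frac12$ given by $$ \begin{aligned} &\Vert \mathbf{B}:\delta^{(k)}\boldsymbol{\sigma}\Vert_{\Omega}^2+\overbrace{\Vert\delta^{(k)}p_h\Vert_{\Omega}^2}^{\ge 0}+\overbrace{\frac{3}{C}\Delta t\,\Vert\boldsymbol{\kappa}^{-1/2}\delta^{(k)}\mathbf{z}_h\Vert_{\Omega}^2}^{\ge 0}+\overbrace{\frac{3}{C}\big(\delta^{(k)}\boldsymbol{\sigma}:\mathbb{D}^{-1}\delta^{(k)}\boldsymbol{\sigma}\big)_{\Omega}}^{\ge 0}+\overbrace{\frac{3}{2C^2}\Vert\delta^{(k)}\zeta\Vert_{\Omega}^2}^{\ge 0}\\ &\quad-\overbrace{\frac{3}{C^2}\bigg[\frac{7}{2}\Vert\delta^{(k)}_p\zeta-\delta^{(k)}_p\phi^p\Vert_{\Omega}^2+\frac12\Vert\delta^{(k)}\phi^p\Vert_{\Omega}^2+\frac{C}{3}\big(\mathbf{B}:\delta^{(k)}\boldsymbol{\sigma},\delta^{(k)}\phi^p\big)_{\Omega}\bigg]}^{\rightarrow 0}\ \le\ \gamma\,\Vert\mathbf{B}:\delta^{(k-1)}\boldsymbol{\sigma}\Vert_{\Omega}^2, \end{aligned} $$ where the term $$ \frac{3}{C^2}\bigg[\frac{7}{2}\Vert\delta^{(k)}_p\zeta-\delta^{(k)}_p\phi^p\Vert_{\Omega}^2+\frac12\Vert\delta^{(k)}\phi^p\Vert_{\Omega}^2+\frac{C}{3}\big(\mathbf{B}:\delta^{(k)}\boldsymbol{\sigma},\delta^{(k)}\phi^p\big)_{\Omega}\bigg]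 $$ is driven to a small value by the convergence criterion (stated in the context). The reason behind driving this term to a small value is to minimize the influence of the negativity of the term (it enters the left-hand side with a minus sign) on the quality of the contraction mapping.
   Context: **Notation.** $\Omega\subset\mathbb{R}^3$ is the domain, with boundary decomposed as $\partial\Omega=\Gamma_D^f\cup\Gamma_N^f$ (flow Dirichlet/Neumann) and as $\partial\Omega=\Gamma_D^p\cup\Gamma_N^p$ (mechanics Dirichlet/Neumann). $(\cdot,\cdot)_\Omega$ and $\Vert\cdot\Vert_\Omega$ are the $L^2(\Omega)$ inner product and norm (scalar or vector valued). For second-order tensors, $\boldsymbol{\sigma}:\boldsymbol{\tau}$ is the full contraction and $(\boldsymbol{\sigma}:\boldsymbol{\tau})_\Omega=\int_\Omega\boldsymbol{\sigma}:\boldsymbol{\tau}$. $(\cdot,\cdot)_{\Gamma}$ is the $L^2$ pairing on a boundary part $\Gamma$; $\mathbf{n}$ is the unit outward normal. **Data.** $\boldsymbol{\kappa}=\mathbf{K}/\mu$, where $\mathbf{K}$ is the uniformly symmetric positive definite permeability tensor and $\mu$ the fluid viscosity; $\mathbb{D}$ is the fourth-order symmetric positive definite anisotropic elasticity tensor; $\boldsymbol{\alpha}$ is the Biot tensor; $M>0$ is the Biot modulus; $C>0$ is a generalized Hooke's law constant; $\mathbf{B}$ is the (second-order tensor) Skempton pore pressure coefficient; $\boldsymbol{\beta}$ is a second-order tensor material parameter; $\Delta t$ is the time step. The source $q$, Dirichlet pressure $g$, reference density $\rho_0$, gravity vector $\mathbf{g}$, traction $\mathbf{t}$ and body force $\mathbf{f}$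 are given, and in the discrete equations below do not depend on the coupling iteration. **Constitutive relations.** The unknowns are fluid pressure $p$, fluid flux $\mathbf{z}$ and solid displacement $\mathbf{u}$. In the small strain elastoplastic model, the elastic strain is $\boldsymbol{\epsilon}^e(\mathbf{u})=\frac12(\nabla\mathbf{u}+(\nabla\mathbf{u})^T)\equiv\boldsymbol{\epsilon}(\mathbf{u})-\boldsymbol{\epsilon}^p(\mathbf{u})$ (convention of the model: in the weak forms $\boldsymbol{\epsilon}^e(\cdot)$ is the symmetric gradient), where $\boldsymbol{\epsilon}$ is the strain and $\boldsymbol{\epsilon}^p$ the plastic strain. The plastic strain is given by the flow rule $\boldsymbol{\epsilon}^p=\lambda\,\partial\Phi/\partial\boldsymbol{\sigma}$, where $\Phi(\boldsymbol{\sigma})$ is a scalar yield function and $\lambda\ge0$ is the plastic multiplier with $\lambda\Phi=0$, $\lambda>0\leftrightarrow\Phi=0$, $\lambda=0\leftrightarrow\Phi<0$. The Cauchy stress (symmetric) is $\boldsymbol{\sigma}=\mathbb{D}\boldsymbol{\epsilon}^e-\boldsymbol{\alpha}p$, with inverse $$\boldsymbol{\epsilon}^e=\mathbb{D}^{-1}(\boldsymbol{\sigma}+\boldsymbol{\alpha}p)=\mathbb{D}^{-1}\boldsymbol{\sigma}+\tfrac{C}{3}\mathbf{B}p$$ (so $\mathbb{D}^{-1}\boldsymbol{\alpha}=\frac C3\mathbf{B}$). The plastic porosity is $\phi^p=\boldsymbol{\beta}:\boldsymbol{\epsilon}^p$, and the increment in fluid content is $$\zeta=\tfrac1M p+\boldsymbol{\alpha}:\boldsymbol{\epsilon}^e+\phi^p=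 Cp+\tfrac{C}{3}\mathbf{B}:\boldsymbol{\sigma}+\phi^p .$$ **Discrete spaces.** On a mesh $\mathscr{T}_h$ of $\Omega$: $W_h$ is the space of functions constant on each element; $\mathbf{V}_h$ is a mixed finite element flux space of functions $\mathbf{v}_h$ obtained on each element $E$ by mapping from a reference element space $\hat{\mathbf{V}}(\hat E)$, with $\mathbf{v}_h\cdot\mathbf{n}=0$ on $\Gamma_N^f$ (paired with $W_h$, with $\nabla\cdot\mathbf{v}_h$ well defined in $L^2(\Omega)$); $\mathbf{U}_h$ is the conforming Galerkin space of vector fields that are trilinear ($Q_1$) on each element and vanish on $\Gamma_D^p$. **Fixed stress split scheme.** At time step $n+1$ (values at step $n$ known), coupling iteration $k$ first solves the flow problem with the stress frozen at its previous iterate, then the poromechanics problem with pore pressure frozen. The coupling iterations are repeated until convergence. The iterates $p_h^{k,n+1}\in W_h$, $\mathbf{z}_h^{k,n+1}\in\mathbf{V}_h$, $\mathbf{u}_h^{k,n+1}\in\mathbf{U}_h$ satisfy, for all $\theta_h\in W_h$, $\mathbf{v}_h\in\mathbf{V}_h$, $\mathbf{q}_h\in\mathbf{U}_h$, $$C(p_h^{k,n+1}-p_h^n,\theta_h)_\Omega+\Delta t(\nabla\cdot\mathbf{z}_h^{k,n+1},\theta_h)_\Omega+(\phi^{p^{k,n+1}}-\phi^{p^n},\theta_h)_\Omega=\Delta t(q^{n+1},\theta_h)_\Omega-\tfrac C3(\mathbf{B}:(\boldsymbol{\sigma}^{k-1,n+1}-\boldsymbol{\sigma}^n),\theta_h)_\Omega,$$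 $$(\boldsymbol{\kappa}^{-1}\mathbf{z}_h^{k,n+1},\mathbf{v}_h)_\Omega=-(g,\mathbf{v}_h\cdot\mathbf{n})_{\Gamma_D^f}+(p_h^{k,n+1},\nabla\cdot\mathbf{v}_h)_\Omega+(\rho_0\mathbf{g},\mathbf{v}_h)_\Omega,$$ $$(\mathbf{t}^{n+1},\mathbf{q}_h)_{\Gamma_N^p}-(\boldsymbol{\sigma}^{k,n+1}:\boldsymbol{\epsilon}^e(\mathbf{q}_h))_\Omega+(\mathbf{f}^{n+1},\mathbf{q}_h)_\Omega=0,$$ with $\boldsymbol{\sigma}^{k,n+1}$, $\phi^{p^{k,n+1}}$, $\zeta^{k,n+1}$ related to the iterates by the constitutive relations above (in particular $\boldsymbol{\sigma}^{k,n+1}=\mathbb{D}\boldsymbol{\epsilon}^e(\mathbf{u}_h^{k,n+1})-\boldsymbol{\alpha}p_h^{k,n+1}$). **Differences of iterates.** At the fixed time level, $\delta^{(k)}(\cdot)=(\cdot)^{k+1}-(\cdot)^{k}$ is the change over the $(k+1)$-th coupling iteration. It splits as $\delta^{(k)}(\cdot)=\delta_f^{(k)}(\cdot)+\delta_p^{(k)}(\cdot)$, where $\delta_f^{(k)}(\cdot)$ is the change during the flow solve and $\delta_p^{(k)}(\cdot)$ the change during the poromechanics solve of that iteration. Since stress is fixed during the flow solve, $\delta_f^{(k)}\boldsymbol{\sigma}=\mathbf{0}$; since pore pressure is frozen during the poromechanics solve, $\delta_f^{(k)}p_h=\delta^{(k)}p_h$. The relation $\zeta=Cp+\frac C3\mathbf{B}:\boldsymbol{\sigma}+\phi^p$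 holds at every stage, so the changes $\delta^{(k)}$, $\delta_f^{(k)}$ and $\delta_p^{(k)}$ of $\zeta$ are given by the same linear combination of the corresponding changes of $p_h$, $\boldsymbol{\sigma}$ and $\phi^p$. **Convergence criterion.** No plastic strain accumulates during the flow solve (the stress, hence the yield function, is unchanged), so $\delta_f^{(k)}\boldsymbol{\epsilon}^p=0$ and $\delta_f^{(k)}\phi^p=0$. With this, the subtracted term in the claim equals $$\frac{3}{2C^2}\Big[6\Vert\boldsymbol{\alpha}:\delta^{(k)}_p\boldsymbol{\epsilon}^e\Vert_\Omega^2+\Vert\boldsymbol{\alpha}:\delta^{(k)}_p\boldsymbol{\epsilon}^e+\boldsymbol{\beta}:\delta^{(k)}_p\boldsymbol{\epsilon}^p\Vert_\Omega^2\Big],$$ and the convergence criterion of the algorithm, imposed on the coupling iterations, is $$6\Vert\boldsymbol{\alpha}:\delta^{(k)}_p\boldsymbol{\epsilon}^e\Vert_\Omega^2+\Vert\boldsymbol{\alpha}:\delta^{(k)}_p\boldsymbol{\epsilon}^e+\boldsymbol{\beta}:\delta^{(k)}_p\boldsymbol{\epsilon}^p\Vert_\Omega^2\le TOL,$$ where $TOL>0$ is a pre-specified small tolerance. The annotation "$\rightarrow 0$" in the claim marks the term that this criterion is designed to drive to a small value (ideally zero). *)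

theory Defs
  imports "HOL-Analysis.Analysis"
begin

section \<open>Lebesgue spaces\<close>

text \<open>
  Second-order tensors are elements of \<^typ>\<open>real^3^3\<close>.  The inner product of this type is the full
  contraction, so \<open>S \<bullet> T\<close> is the sum of all \<open>S $ i $ j * T $ i $ j\<close>.
\<close>

definition L2 :: "'a measure \<Rightarrow> ('a \<Rightarrow> 'b::euclidean_space) \<Rightarrow> bool" where
  "L2 M f \<longleftrightarrow> f \<in> borel_measurable M \<and> integrable M (\<lambda>x. (norm (f x))\<^sup>2)"

definition l2ip :: "'a measure \<Rightarrow> ('a \<Rightarrow> 'b::euclidean_space) \<Rightarrow> ('a \<Rightarrow> 'b) \<Rightarrow> real" where
  "l2ip M f g = (LINT x|M. f x \<bullet> g x)"

definition l2norm :: "'a measure \<Rightarrow> ('a \<Rightarrow> 'b::euclidean_space) \<Rightarrow> real" where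
  "l2norm M f = sqrt (l2ip M f f)"

definition bounded_field :: "(real^3) set \<Rightarrow> (real^3 \<Rightarrow> 'b::euclidean_space) \<Rightarrow> bool" where
  "bounded_field \<Omega> f \<longleftrightarrow> f \<in> borel_measurable (lebesgue_on \<Omega>) \<and> bounded (f ` \<Omega>)"


section \<open>Weak derivatives\<close>

text \<open>
  The pair \<open>(\<phi>, g)\<close> is a test function of class \<open>C\<^sup>1\<close> with compact support in \<open>\<Omega>\<close>, together with its
  gradient.  By mollification, these test functions and the smooth ones give the same weak
  derivatives in \<open>L\<^sup>2\<close>.
\<close>

definition test_function :: "(real^3) set \<Rightarrow> (real^3 \<Rightarrow> real) \<Rightarrow> (real^3 \<Rightarrow> real^3) \<Rightarrow> bool" where
  "test_function \<Omega> \<phi> g \<longleftrightarrow>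
     (\<forall>x. GDERIV \<phi> x :> g x) \<and> continuous_on UNIV g \<and>
     compact (closure {x. \<phi> x \<noteq> 0}) \<and> closure {x. \<phi> x \<noteq> 0} \<subseteq> \<Omega>"

definition has_weak_div :: "(real^3) set \<Rightarrow> (real^3 \<Rightarrow> real^3) \<Rightarrow> (real^3 \<Rightarrow> real) \<Rightarrow> bool" where
  "has_weak_div \<Omega> v d \<longleftrightarrow> L2 (lebesgue_on \<Omega>) d \<and>
     (\<forall>\<phi> g. test_function \<Omega> \<phi> g \<longrightarrow>
        (LINT x|lebesgue_on \<Omega>. v x \<bullet> g x) = - (LINT x|lebesgue_on \<Omega>. d x * \<phi> x))"

definition has_weak_grad :: "(real^3) set \<Rightarrow> (real^3 \<Rightarrow> real^3) \<Rightarrow> (real^3 \<Rightarrow> real^3^3) \<Rightarrow> bool" where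
  "has_weak_grad \<Omega> u G \<longleftrightarrow> L2 (lebesgue_on \<Omega>) G \<and>
     (\<forall>\<phi> g. test_function \<Omega> \<phi> g \<longrightarrow>
        (\<forall>i j. (LINT x|lebesgue_on \<Omega>. u x $ i * g x $ j)
               = - (LINT x|lebesgue_on \<Omega>. G x $ i $ j * \<phi> x)))"

text \<open>Weak derivatives are unique only almost everywhere; the choice operator picks a representative.\<close>

definition wdiv :: "(real^3) set \<Rightarrow> (real^3 \<Rightarrow> real^3) \<Rightarrow> real^3 \<Rightarrow> real" where
  "wdiv \<Omega> v = (SOME d. has_weak_div \<Omega> v d)"

definition wgrad :: "(real^3) set \<Rightarrow> (real^3 \<Rightarrow> real^3) \<Rightarrow> real^3 \<Rightarrow> real^3^3" where
  "wgrad \<Omega> u = (SOME G. has_weak_grad \<Omega> u G)"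

definition sym_grad :: "(real^3) set \<Rightarrow> (real^3 \<Rightarrow> real^3) \<Rightarrow> real^3 \<Rightarrow> real^3^3" where
  "sym_grad \<Omega> u x = (1/2) *\<^sub>R (wgrad \<Omega> u x + transpose (wgrad \<Omega> u x))"

definition H_div :: "(real^3) set \<Rightarrow> (real^3 \<Rightarrow> real^3) \<Rightarrow> bool" where
  "H_div \<Omega> v \<longleftrightarrow> L2 (lebesgue_on \<Omega>) v \<and> (\<exists>d. has_weak_div \<Omega> v d)"

definition H1 :: "(real^3) set \<Rightarrow> (real^3 \<Rightarrow> real^3) \<Rightarrow> bool" where
  "H1 \<Omega> u \<longleftrightarrow> L2 (lebesgue_on \<Omega>) u \<and> (\<exists>G. has_weak_grad \<Omega> u G)"


section \<open>Surface measure, outward normal and traces\<close>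

text \<open>
  The surface measure is the two-dimensional Hausdorff measure, normalised by \<open>\<pi>/4\<close> so that it is the
  area on smooth surfaces.  Being a metric outer measure, it is countably additive on Borel sets.
\<close>

definition hausdorff2 :: "(real^3) set \<Rightarrow> ennreal" where
  "hausdorff2 A =
     (SUP \<delta>\<in>{0::real<..}. INF U\<in>{U::nat \<Rightarrow> (real^3) set.
          A \<subseteq> (\<Union>i. U i) \<and> (\<forall>i. bounded (U i) \<and> diameter (U i) \<le> \<delta>)}.
        (\<Sum>i. ennreal (pi / 4 * (diameter (U i))\<^sup>2)))"

definition surface_on :: "(real^3) set \<Rightarrow> (real^3) measure" where
  "surface_on \<Gamma> = restrict_space (measure_of UNIV (sets borel) hausdorff2) \<Gamma>"

text \<open>
  The measure-theoretic outward unit normal: to leading order, \<open>\<Omega>\<close> fills near \<open>x\<close> exactly the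
  half-space on the negative side of \<open>n\<close>.
\<close>

definition outer_normal :: "(real^3) set \<Rightarrow> real^3 \<Rightarrow> real^3" where
  "outer_normal \<Omega> x = (THE n. norm n = 1 \<and>
     ((\<lambda>r. measure lebesgue ({y \<in> ball x r. y \<in> \<Omega> \<and> 0 < (y - x) \<bullet> n} \<union>
                             {y \<in> ball x r. y \<notin> \<Omega> \<and> (y - x) \<bullet> n < 0}) / r ^ 3)
        \<longlongrightarrow> 0) (at_right 0))"

text \<open>
  Flux functions are continuous up to the boundary in each element but arbitrary on the interfaces.
  Their boundary values are limits from inside, which exist at all points of the boundary that belong
  to one element only, hence almost everywhere.
\<close>

definition btrace :: "(real^3) set \<Rightarrow> (real^3 \<Rightarrow> real^3) \<Rightarrow> real^3 \<Rightarrow> real^3" where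
  "btrace \<Omega> v x = Lim (at x within \<Omega>) v"


section \<open>Tensors\<close>

definition sym_tensor :: "real^3^3 \<Rightarrow> bool" where
  "sym_tensor A \<longleftrightarrow> transpose A = A"

text \<open>The tensor with entries \<open>\<Sum>k l. D $ i $ j $ k $ l * e $ k $ l\<close>.\<close>

definition tapply :: "real^3^3^3^3 \<Rightarrow> real^3^3 \<Rightarrow> real^3^3" where
  "tapply D e = (\<chi> i j. D $ i $ j \<bullet> e)"

definition elasticity_tensor :: "real^3^3^3^3 \<Rightarrow> bool" where
  "elasticity_tensor D \<longleftrightarrow>
     (\<forall>i j k l. D $ i $ j $ k $ l = D $ k $ l $ i $ j \<and>
                D $ i $ j $ k $ l = D $ j $ i $ k $ l \<and>
                D $ i $ j $ k $ l = D $ i $ j $ l $ k) \<and>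
     (\<forall>e. sym_tensor e \<and> e \<noteq> 0 \<longrightarrow> 0 < e \<bullet> tapply D e)"

text \<open>
  An elasticity tensor annihilates skew tensors, so its inverse is the one on symmetric tensors.
\<close>

definition compliance :: "real^3^3^3^3 \<Rightarrow> real^3^3 \<Rightarrow> real^3^3" where
  "compliance D s = (THE e. sym_tensor e \<and> tapply D e = s)"

text \<open>The (unique) symmetric positive semidefinite square root of such a matrix.\<close>

definition psd_sqrt :: "real^3^3 \<Rightarrow> real^3^3" where
  "psd_sqrt A = (SOME R. sym_tensor R \<and> (\<forall>v. 0 \<le> v \<bullet> (R *v v)) \<and> R ** R = A)"

definition uniformly_spd :: "(real^3) set \<Rightarrow> (real^3 \<Rightarrow> real^3^3) \<Rightarrow> bool" where
  "uniformly_spd \<Omega> K \<longleftrightarrow> bounded_field \<Omega> K \<and> (\<forall>x\<in>\<Omega>. sym_tensor (K x)) \<and>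
     (\<exists>c>0. \<forall>x\<in>\<Omega>. \<forall>v. c * (v \<bullet> v) \<le> v \<bullet> (K x *v v))"

text \<open>The gradient \<open>N\<close> of a scalar function of the symmetric stress tensor.\<close>

definition has_stress_gradient :: "(real^3^3 \<Rightarrow> real) \<Rightarrow> real^3^3 \<Rightarrow> real^3^3 \<Rightarrow> bool" where
  "has_stress_gradient \<Phi> s N \<longleftrightarrow>
     sym_tensor N \<and> (\<Phi> has_derivative (\<lambda>t. N \<bullet> t)) (at s within Collect sym_tensor)"

definition flow_rule :: "(real^3^3 \<Rightarrow> real) \<Rightarrow> real^3^3 \<Rightarrow> real^3^3 \<Rightarrow> real \<Rightarrow> bool" where
  "flow_rule \<Phi> s ep lam \<longleftrightarrow>
     0 \<le> lam \<and> lam * \<Phi> s = 0 \<and> (0 < lam \<longleftrightarrow> \<Phi> s = 0) \<and> (lam = 0 \<longleftrightarrow> \<Phi> s < 0) \<and>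
     (\<exists>N. has_stress_gradient \<Phi> s N \<and> ep = lam *\<^sub>R N)"


section \<open>Hexahedral meshes\<close>

text \<open>
  Each element is the image of the closed unit cube \<open>cbox 0 1\<close> under a nondegenerate trilinear map;
  a mesh is represented by its finite set of element maps.
\<close>

definition trilinear :: "(real^3 \<Rightarrow> real^3) \<Rightarrow> bool" where
  "trilinear f \<longleftrightarrow> (\<exists>c :: 3 set \<Rightarrow> real^3. \<forall>x. f x = (\<Sum>I\<in>UNIV. (\<Prod>i\<in>I. x $ i) *\<^sub>R c I))"

definition jacobian :: "(real^3 \<Rightarrow> real^3) \<Rightarrow> real^3 \<Rightarrow> real^3^3" where
  "jacobian F x = matrix (frechet_derivative F (at x))"

definition hex_mesh :: "(real^3) set \<Rightarrow> (real^3 \<Rightarrow> real^3) set \<Rightarrow> bool" where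
  "hex_mesh \<Omega> T \<longleftrightarrow> finite T \<and>
     (\<forall>F\<in>T. trilinear F \<and> inj_on F (cbox 0 1) \<and> (\<forall>x\<in>cbox 0 1. 0 < det (jacobian F x)) \<and>
            F ` box 0 1 \<subseteq> \<Omega>) \<and>
     (\<forall>F\<in>T. \<forall>G\<in>T. F \<noteq> G \<longrightarrow> F ` box 0 1 \<inter> G ` box 0 1 = {}) \<and>
     closure \<Omega> = (\<Union>F\<in>T. F ` cbox 0 1)"

text \<open>A finite-dimensional linear space of continuous vector fields on the reference cube.\<close>

definition reference_space :: "(real^3 \<Rightarrow> real^3) set \<Rightarrow> bool" where
  "reference_space V \<longleftrightarrow>
     (\<exists>(n::nat) b. (\<forall>i<n. continuous_on (cbox 0 1) (b i)) \<and>
        V = range (\<lambda>(c::nat \<Rightarrow> real) x. \<Sum>i<n. c i *\<^sub>R b i x))"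


section \<open>The coupled problem\<close>

record poro_problem =
  dom :: "(real^3) set"
  flowD :: "(real^3) set"
  flowN :: "(real^3) set"
  mechD :: "(real^3) set"
  mechN :: "(real^3) set"
  mesh :: "(real^3 \<Rightarrow> real^3) set"
  Vref :: "(real^3 \<Rightarrow> real^3) set"
  permeability :: "real^3 \<Rightarrow> real^3^3"
  viscosity :: real
  elasticity :: "real^3 \<Rightarrow> real^3^3^3^3"
  biot :: "real^3 \<Rightarrow> real^3^3"
  biot_modulus :: real
  hooke :: real
  skempton :: "real^3 \<Rightarrow> real^3^3"
  beta :: "real^3 \<Rightarrow> real^3^3"
  yieldf :: "real^3^3 \<Rightarrow> real"
  tstep :: real
  source :: "real^3 \<Rightarrow> real"
  presD :: "real^3 \<Rightarrow> real"
  rho0 :: real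
  gravity :: "real^3"
  traction :: "real^3 \<Rightarrow> real^3"
  bforce :: "real^3 \<Rightarrow> real^3"

definition kappa :: "poro_problem \<Rightarrow> real^3 \<Rightarrow> real^3^3" where
  "kappa P x = (1 / viscosity P) *\<^sub>R permeability P x"

abbreviation leb :: "poro_problem \<Rightarrow> (real^3) measure" where
  "leb P \<equiv> lebesgue_on (dom P)"

definition wellposed_data :: "poro_problem \<Rightarrow> bool" where
  "wellposed_data P \<longleftrightarrow>
     open (dom P) \<and> connected (dom P) \<and> bounded (dom P) \<and> dom P \<noteq> {} \<and>
     flowD P \<in> sets borel \<and> flowN P \<in> sets borel \<and> frontier (dom P) = flowD P \<union> flowN P \<and>
     mechD P \<in> sets borel \<and> mechN P \<in> sets borel \<and> frontier (dom P) = mechD P \<union> mechN P \<and>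
     hex_mesh (dom P) (mesh P) \<and> reference_space (Vref P) \<and>
     uniformly_spd (dom P) (permeability P) \<and> 0 < viscosity P \<and>
     bounded_field (dom P) (elasticity P) \<and> (\<forall>x\<in>dom P. elasticity_tensor (elasticity P x)) \<and>
     bounded_field (dom P) (biot P) \<and> (\<forall>x\<in>dom P. sym_tensor (biot P x)) \<and>
     bounded_field (dom P) (skempton P) \<and>
     (\<forall>x\<in>dom P. compliance (elasticity P x) (biot P x) = (hooke P / 3) *\<^sub>R skempton P x) \<and>
     bounded_field (dom P) (beta P) \<and>
     0 < biot_modulus P \<and> 0 < hooke P \<and> 0 < tstep P \<and>
     L2 (leb P) (source P) \<and> L2 (leb P) (bforce P) \<and>
     L2 (surface_on (flowD P)) (presD P) \<and> L2 (surface_on (mechN P)) (traction P)"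


section \<open>Discrete spaces\<close>

definition W_h :: "poro_problem \<Rightarrow> (real^3 \<Rightarrow> real) set" where
  "W_h P = {w. L2 (leb P) w \<and> (\<forall>F\<in>mesh P. \<exists>c. \<forall>x\<in>box 0 1. w (F x) = c)}"

text \<open>Fluxes are mapped from the reference element by the contravariant Piola transformation.\<close>

definition V_h :: "poro_problem \<Rightarrow> (real^3 \<Rightarrow> real^3) set" where
  "V_h P = {v. H_div (dom P) v \<and>
     (\<forall>F\<in>mesh P. \<exists>w\<in>Vref P. \<forall>x\<in>box 0 1.
        v (F x) = (1 / det (jacobian F x)) *\<^sub>R (jacobian F x *v w x)) \<and>
     (AE x in surface_on (flowN P).
        ((\<lambda>y. v y \<bullet> outer_normal (dom P) x) \<longlongrightarrow> 0) (at x within dom P))}"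

text \<open>
  Trilinearity is required in reference coordinates on closed elements, which makes the functions
  continuous on the closure of the domain; their boundary values are the pointwise ones.
\<close>

definition U_h :: "poro_problem \<Rightarrow> (real^3 \<Rightarrow> real^3) set" where
  "U_h P = {u. H1 (dom P) u \<and>
     (\<forall>F\<in>mesh P. \<exists>w. trilinear w \<and> (\<forall>x\<in>cbox 0 1. u (F x) = w x)) \<and>
     (\<forall>x\<in>mechD P. u x = 0)}"


section \<open>The fixed stress split scheme\<close>

record poro_state =
  pressure :: "real^3 \<Rightarrow> real"
  flux :: "real^3 \<Rightarrow> real^3"
  displ :: "real^3 \<Rightarrow> real^3"
  strain :: "real^3 \<Rightarrow> real^3^3"
  estrain :: "real^3 \<Rightarrow> real^3^3"
  pstrain :: "real^3 \<Rightarrow> real^3^3"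
  stress :: "real^3 \<Rightarrow> real^3^3"
  pporosity :: "real^3 \<Rightarrow> real"
  fcontent :: "real^3 \<Rightarrow> real"

definition square_integrable_state :: "poro_problem \<Rightarrow> poro_state \<Rightarrow> bool" where
  "square_integrable_state P s \<longleftrightarrow>
     L2 (leb P) (pressure s) \<and> L2 (leb P) (flux s) \<and> L2 (leb P) (strain s) \<and>
     L2 (leb P) (estrain s) \<and> L2 (leb P) (pstrain s) \<and> L2 (leb P) (stress s) \<and>
     L2 (leb P) (pporosity s) \<and> L2 (leb P) (fcontent s)"

definition constitutive :: "poro_problem \<Rightarrow> poro_state \<Rightarrow> bool" where
  "constitutive P s \<longleftrightarrow> (AE x in leb P.
     sym_tensor (stress s x) \<and>
     estrain s x = strain s x - pstrain s x \<and>
     stress s x = tapply (elasticity P x) (estrain s x) - pressure s x *\<^sub>R biot P x \<and>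
     estrain s x = compliance (elasticity P x) (stress s x)
                   + (hooke P / 3 * pressure s x) *\<^sub>R skempton P x \<and>
     pporosity s x = beta P x \<bullet> pstrain s x \<and>
     fcontent s x = pressure s x / biot_modulus P + biot P x \<bullet> estrain s x + pporosity s x \<and>
     fcontent s x = hooke P * pressure s x + hooke P / 3 * (skempton P x \<bullet> stress s x)
                    + pporosity s x)"

text \<open>
  Mass balance: \<open>p\<close>, \<open>z\<close> and \<open>phi\<close> carry the index of the current coupling iteration, \<open>sig\<close> is the
  stress of the previous one, and \<open>sn\<close> is the state at the previous time step.
\<close>

definition mass_balance ::
    "poro_problem \<Rightarrow> poro_state \<Rightarrow> (real^3 \<Rightarrow> real) \<Rightarrow> (real^3 \<Rightarrow> real^3) \<Rightarrow> (real^3 \<Rightarrow> real) \<Rightarrow>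
     (real^3 \<Rightarrow> real^3^3) \<Rightarrow> bool" where
  "mass_balance P sn p z phi sig \<longleftrightarrow> (\<forall>th\<in>W_h P.
     hooke P * l2ip (leb P) (\<lambda>x. p x - pressure sn x) th
     + tstep P * l2ip (leb P) (wdiv (dom P) z) th
     + l2ip (leb P) (\<lambda>x. phi x - pporosity sn x) th
     = tstep P * l2ip (leb P) (source P) th
       - hooke P / 3 * l2ip (leb P) (\<lambda>x. skempton P x \<bullet> (sig x - stress sn x)) th)"

definition darcy :: "poro_problem \<Rightarrow> (real^3 \<Rightarrow> real) \<Rightarrow> (real^3 \<Rightarrow> real^3) \<Rightarrow> bool" where
  "darcy P p z \<longleftrightarrow> (\<forall>v\<in>V_h P.
     l2ip (leb P) (\<lambda>x. matrix_inv (kappa P x) *v z x) v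
     = - l2ip (surface_on (flowD P)) (presD P)
             (\<lambda>x. btrace (dom P) v x \<bullet> outer_normal (dom P) x)
       + l2ip (leb P) p (wdiv (dom P) v)
       + l2ip (leb P) (\<lambda>x. rho0 P *\<^sub>R gravity P) v)"

definition equilibrium :: "poro_problem \<Rightarrow> (real^3 \<Rightarrow> real^3^3) \<Rightarrow> bool" where
  "equilibrium P sig \<longleftrightarrow> (\<forall>q\<in>U_h P.
     l2ip (surface_on (mechN P)) (traction P) q - l2ip (leb P) sig (sym_grad (dom P) q)
     + l2ip (leb P) (bforce P) q = 0)"

text \<open>
  One coupling iteration: \<open>s\<close> is the previous iterate, \<open>h\<close> the intermediate state reached by the flow
  solve (stress and plastic strain frozen) and \<open>s'\<close> the new iterate reached from \<open>h\<close> by the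
  poromechanics solve (pore pressure and flux frozen).  The flow rule determines the plastic strain
  of \<open>s'\<close>, and the plastic porosity in the mass balance is that of \<open>s'\<close>.
\<close>

definition coupling_iteration ::
    "poro_problem \<Rightarrow> poro_state \<Rightarrow> poro_state \<Rightarrow> poro_state \<Rightarrow> poro_state \<Rightarrow> bool" where
  "coupling_iteration P sn s h s' \<longleftrightarrow>
     square_integrable_state P h \<and> square_integrable_state P s' \<and>
     pressure s' \<in> W_h P \<and> flux s' \<in> V_h P \<and> displ s' \<in> U_h P \<and>
     (AE x in leb P. stress h x = stress s x \<and> pstrain h x = pstrain s x) \<and>
     (AE x in leb P. pressure s' x = pressure h x \<and> flux s' x = flux h x) \<and>
     constitutive P h \<and> constitutive P s' \<and>
     (AE x in leb P. estrain s' x = sym_grad (dom P) (displ s') x) \<and>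
     (\<exists>lam. AE x in leb P. flow_rule (yieldf P) (stress s' x) (pstrain s' x) (lam x)) \<and>
     mass_balance P sn (pressure s') (flux s') (pporosity s') (stress s) \<and>
     darcy P (pressure s') (flux s') \<and>
     equilibrium P (stress s')"

text \<open>
  \<open>S k\<close> is the iterate after \<open>k\<close> coupling iterations, \<open>S 0\<close> an initial guess, and \<open>H k\<close> the state
  between the two solves that lead from \<open>S k\<close> to \<open>S (Suc k)\<close>.
\<close>

definition fixed_stress_scheme ::
    "poro_problem \<Rightarrow> poro_state \<Rightarrow> (nat \<Rightarrow> poro_state) \<Rightarrow> (nat \<Rightarrow> poro_state) \<Rightarrow> bool" where
  "fixed_stress_scheme P sn S H \<longleftrightarrow>
     pressure sn \<in> W_h P \<and> L2 (leb P) (stress sn) \<and> L2 (leb P) (pporosity sn) \<and>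
     L2 (leb P) (stress (S 0)) \<and>
     (\<forall>k. coupling_iteration P sn (S k) (H k) (S (Suc k)))"

definition diff ::
    "(nat \<Rightarrow> poro_state) \<Rightarrow> (poro_state \<Rightarrow> real^3 \<Rightarrow> 'a::real_vector) \<Rightarrow> nat \<Rightarrow> real^3 \<Rightarrow> 'a" where
  "diff S X k x = X (S (Suc k)) x - X (S k) x"

definition diff_p ::
    "(nat \<Rightarrow> poro_state) \<Rightarrow> (nat \<Rightarrow> poro_state) \<Rightarrow> (poro_state \<Rightarrow> real^3 \<Rightarrow> 'a::real_vector) \<Rightarrow>
     nat \<Rightarrow> real^3 \<Rightarrow> 'a" where
  "diff_p S H X k x = X (S (Suc k)) x - X (H k) x"

definition negative_term ::
    "poro_problem \<Rightarrow> (nat \<Rightarrow> poro_state) \<Rightarrow> (nat \<Rightarrow> poro_state) \<Rightarrow> nat \<Rightarrow> real" where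
  "negative_term P S H k = 3 / (hooke P)\<^sup>2 *
     (7/2 * (l2norm (leb P) (\<lambda>x. diff_p S H fcontent k x - diff_p S H pporosity k x))\<^sup>2
      + 1/2 * (l2norm (leb P) (diff S pporosity k))\<^sup>2
      + hooke P / 3 * l2ip (leb P) (\<lambda>x. skempton P x \<bullet> diff S stress k x) (diff S pporosity k))"

text \<open>The quantity that the convergence criterion requires to be at most the tolerance.\<close>

definition criterion_quantity ::
    "poro_problem \<Rightarrow> (nat \<Rightarrow> poro_state) \<Rightarrow> (nat \<Rightarrow> poro_state) \<Rightarrow> nat \<Rightarrow> real" where
  "criterion_quantity P S H k =
     6 * (l2norm (leb P) (\<lambda>x. biot P x \<bullet> diff_p S H estrain k x))\<^sup>2
     + (l2norm (leb P) (\<lambda>x. biot P x \<bullet> diff_p S H estrain k x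
                            + beta P x \<bullet> diff_p S H pstrain k x))\<^sup>2"

end

theory Submission
  imports Defs
begin

text \<open>
  Write \<open>b = B : \<delta>\<sigma>\<close>, \<open>p\<close>, \<open>z\<close>, \<open>\<phi>\<close>, \<open>\<zeta>\<close> for the changes over the current coupling iteration and \<open>b\<^sub>0\<close> for
  the change of \<open>B : \<sigma>\<close> over the previous one.  The source, the body force, the traction and the
  boundary pressure are the same in two consecutive iterations, so they cancel in the difference of
  the discrete equations.  Testing these differences with the changes themselves gives three energy
  identities (\<open>mass_balance_change\<close>, \<open>darcy_change\<close>, \<open>equilibrium_change\<close>):

    \<^item> mass balance: \<open>C \<parallel>p\<parallel>\<^sup>2 + \<Delta>t (div z, p) + (\<phi>, p) = - C/3 (b\<^sub>0, p)\<close>;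
    \<^item> Darcy's law: \<open>(\<kappa>\<^sup>-\<^sup>1 z, z) = (p, div z)\<close>;
    \<^item> equilibrium: \<open>(\<delta>\<sigma>, \<delta>\<epsilon>\<^sup>e) = 0\<close>, which is \<open>(\<delta>\<sigma>, D\<^sup>-\<^sup>1 \<delta>\<sigma>) = - C/3 (b, p)\<close> because
      \<open>\<delta>\<epsilon>\<^sup>e = D\<^sup>-\<^sup>1 \<delta>\<sigma> + C/3 p B\<close>.

  Expand \<open>\<parallel>\<zeta>\<parallel>\<^sup>2\<close> with \<open>\<zeta> = C p + C/3 b + \<phi>\<close>.  In the negative term, \<open>\<delta>\<^sub>p\<zeta> - \<delta>\<^sub>p\<phi> = C/3 b\<close>, because
  the poromechanics solve keeps the pressure while the flow solve keeps the stress.  The coefficients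
  3/C, 3/(2 C^2) and 7/2 are such that \<open>\<parallel>b\<parallel>\<^sup>2\<close>, \<open>\<parallel>\<phi>\<parallel>\<^sup>2\<close>, \<open>(b, \<phi>)\<close> and, by the equilibrium identity,
  \<open>(b, p)\<close> all cancel.  What is left of the left-hand side is

    \<open>5/2 \<parallel>p\<parallel>\<^sup>2 + 3/C (\<Delta>t \<parallel>\<kappa>\<^sup>-\<^sup>1\<^sup>/\<^sup>2 z\<parallel>\<^sup>2 + (\<phi>, p)) = - 1/2 \<parallel>p\<parallel>\<^sup>2 - (b\<^sub>0, p) \<le> 1/2 \<parallel>b\<^sub>0\<parallel>\<^sup>2\<close>

  by mass balance, Darcy's law and Young's inequality (\<open>contraction\<close>).  The negative term is a multiple
  of the criterion quantity since \<open>\<alpha> : \<delta>\<^sub>p\<epsilon>\<^sup>e\<close> is also equal to \<open>C/3 b\<close>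
  (\<open>negative_term_eq_criterion\<close>).

  Besides this algebra, the norm of \<open>\<kappa>\<^sup>-\<^sup>1\<^sup>/\<^sup>2 z\<close> needs the existence of square roots of positive
  semidefinite matrices (from the spectral theorem), the compliance must be shown to be a linear,
  positive map on symmetric tensors, and the integrals can be split only after \<open>\<kappa>\<^sup>-\<^sup>1 z\<close>, \<open>D\<^sup>-\<^sup>1 \<delta>\<sigma>\<close>
  and \<open>div z\<close> are known to be square integrable.
\<close>


section \<open>Square roots of positive semidefinite matrices\<close>

text \<open>
  A maximiser \<open>v\<close> of the Rayleigh quotient over the unit sphere of \<open>S\<close> is an eigenvector: otherwise
  the quotient would increase from \<open>v\<close> in the direction of the residual \<open>w = f v - c v\<close>.
\<close>

lemma selfadjoint_eigenvector:
  fixes f :: "'a::euclidean_space \<Rightarrow> 'a"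
  assumes f: "linear f" and sa: "\<And>x y. x \<bullet> f y = f x \<bullet> y"
    and S: "subspace S" "f ` S \<subseteq> S" "S \<noteq> {0}"
  shows "\<exists>v\<in>S. \<exists>c. norm v = 1 \<and> f v = c *\<^sub>R v"
proof -
  let ?K = "S \<inter> sphere 0 1"
  have "compact ?K"
    using S(1) by (simp add: closed_Int_compact closed_subspace)
  moreover have "?K \<noteq> {}"
  proof -
    obtain w where w: "w \<in> S" "w \<noteq> 0" using S subspace_0 by blast
    then have "(1 / norm w) *\<^sub>R w \<in> ?K" using S(1) by (simp add: subspace_scale)
    then show ?thesis by blast
  qed
  moreover have "continuous_on ?K (\<lambda>x. x \<bullet> f x)"
    using f by (intro continuous_intros linear_continuous_on) (simp add: linear_conv_bounded_linear)
  ultimately obtain v where v: "v \<in> ?K" and vmax: "\<And>y. y \<in> ?K \<Longrightarrow> y \<bullet> f y \<le> v \<bullet> f v"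
    using continuous_attains_sup by (metis (no_types, lifting))
  define c where "c = v \<bullet> f v"
  define w where "w = f v - c *\<^sub>R v"
  have vv: "v \<bullet> v = 1" "norm v = 1" "v \<in> S" using v by (auto simp: dot_square_norm)
  have le: "x \<bullet> f x \<le> c * (x \<bullet> x)" if "x \<in> S" for x
  proof (cases "x = 0")
    case False
    have "(1 / norm x) *\<^sub>R x \<in> ?K" using that False S(1) by (simp add: subspace_scale)
    from vmax[OF this] have "(x \<bullet> f x) / (norm x * norm x) \<le> c"
      by (simp add: c_def linear_cmul[OF f])
    then show ?thesis using False by (simp add: field_simps dot_square_norm power2_eq_square)
  qed simp
  have wS: "w \<in> S" unfolding w_def using S vv by (intro subspace_diff subspace_scale) auto
  have fv: "f v = w + c *\<^sub>R v" by (simp add: w_def)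
  have vw: "v \<bullet> w = 0" unfolding w_def by (simp add: inner_diff_right vv flip: c_def)
  define d where "d = c * (w \<bullet> w) - w \<bullet> f w"
  \<comment> \<open>The inequality \<open>le\<close> at \<open>v + t w\<close>: its terms of order 0 cancel, so the linear term must vanish.\<close>
  have quad: "2 * t * (w \<bullet> w) \<le> t\<^sup>2 * d" for t
  proof -
    have "v + t *\<^sub>R w \<in> S" using S vv wS by (intro subspace_add subspace_scale) auto
    from le[OF this] have "(v + t *\<^sub>R w) \<bullet> (f v + t *\<^sub>R f w) \<le> c * ((v + t *\<^sub>R w) \<bullet> (v + t *\<^sub>R w))"
      by (simp add: linear_add[OF f] linear_cmul[OF f])
    moreover have "v \<bullet> f w = w \<bullet> w" using sa[of v w] fv vw by (simp add: inner_add_left)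
    ultimately show ?thesis
      using vw vv unfolding fv d_def
      by (simp add: inner_add_left inner_add_right algebra_simps power2_eq_square inner_commute[of w v])
  qed
  have "w \<bullet> w \<le> 0"
  proof (rule ccontr)
    assume "\<not> w \<bullet> w \<le> 0"
    then have pos: "w \<bullet> w > 0" by linarith
    \<comment> \<open>A step so short that the quadratic term cannot compensate the linear one, even if \<open>d = 0\<close>.\<close>
    define t where "t = (w \<bullet> w) / (\<bar>d\<bar> + 1)"
    have t: "t > 0" "t * (\<bar>d\<bar> + 1) = w \<bullet> w" using pos by (auto simp: t_def)
    have "2 * (w \<bullet> w) \<le> t * d" using quad[of t] t(1) by (simp add: power2_eq_square)
    also have "\<dots> \<le> t * (\<bar>d\<bar> + 1)" using t(1) by (intro mult_left_mono) auto
    finally show False using t pos by simp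
  qed
  then have "w = 0" by (metis inner_eq_zero_iff inner_ge_zero order_antisym)
  then show ?thesis using fv vv by auto
qed

text \<open>
  Split off one eigenvector; self-adjointness makes its orthogonal complement within \<open>S\<close> invariant.
  An arbitrary invariant subspace instead of the whole space is what makes this induction on the
  dimension possible.
\<close>

lemma selfadjoint_orthonormal_eigenbasis:
  fixes f :: "'a::euclidean_space \<Rightarrow> 'a"
  assumes f: "linear f" and sa: "\<And>x y. x \<bullet> f y = f x \<bullet> y"
    and "subspace S" "f ` S \<subseteq> S"
  shows "\<exists>B. finite B \<and> B \<subseteq> S \<and> S \<subseteq> span B \<and> pairwise orthogonal B \<and>
             (\<forall>b\<in>B. norm b = 1 \<and> (\<exists>c. f b = c *\<^sub>R b))"
  using assms(3,4)
proof (induction "dim S" arbitrary: S rule: less_induct)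
  case less
  show ?case
  proof (cases "S = {0}")
    case True
    then show ?thesis by (intro exI[of _ "{}"]) (auto simp: pairwise_def)
  next
    case False
    obtain v c where v: "v \<in> S" "norm v = 1" "f v = c *\<^sub>R v"
      using selfadjoint_eigenvector[OF f sa less.prems False] by blast
    have vv: "v \<bullet> v = 1" using v by (simp add: dot_square_norm)
    define T where "T = {x \<in> S. v \<bullet> x = 0}"
    have T: "subspace T"
      using less.prems(1) unfolding T_def subspace_def by (auto simp: inner_add_right)
    have fT: "f ` T \<subseteq> T"
      using less.prems(2) sa[of v] v(3) unfolding T_def by auto
    have "v \<notin> T" using vv by (simp add: T_def)
    then have "T \<subset> S" using v(1) unfolding T_def by blast
    then have "dim T < dim S"
      by (metis T dim_psubset less.prems(1) span_eq_iff)
    from less.hyps[OF this T fT] obtain B where B: "finite B" "B \<subseteq> T" "T \<subseteq> span B"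
      "pairwise orthogonal B" "\<forall>b\<in>B. norm b = 1 \<and> (\<exists>c. f b = c *\<^sub>R b)" by blast
    have "S \<subseteq> span (insert v B)"
    proof
      fix x assume x: "x \<in> S"
      have "x - (v \<bullet> x) *\<^sub>R v \<in> T"
        unfolding T_def using x v(1) vv less.prems(1)
        by (auto simp: inner_diff_right intro: subspace_diff subspace_scale)
      then show "x \<in> span (insert v B)" using B(3) unfolding span_insert by auto
    qed
    moreover have "pairwise orthogonal (insert v B)"
      using B(2,4) by (auto simp: pairwise_insert T_def orthogonal_def inner_commute)
    ultimately show ?thesis
      using B v unfolding T_def by (intro exI[of _ "insert v B"]) auto
  qed
qed

text \<open>
  The eigenvalues are nonnegative, so the map that multiplies each vector of an eigenbasis by the square
  root of its eigenvalue is the required root.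
\<close>

lemma psd_sqrt_exists:
  fixes A :: "real^3^3"
  assumes sym: "sym_tensor A" and psd: "\<And>v. 0 \<le> v \<bullet> (A *v v)"
  shows "\<exists>R. sym_tensor R \<and> (\<forall>v. 0 \<le> v \<bullet> (R *v v)) \<and> R ** R = A"
proof -
  let ?f = "(*v) A"
  have sa: "x \<bullet> ?f y = ?f x \<bullet> y" for x y
    using sym by (metis dot_lmul_matrix sym_tensor_def transpose_matrix_vector)
  obtain B where B: "finite B" "UNIV \<subseteq> span B" "pairwise orthogonal B"
      "\<And>b. b \<in> B \<Longrightarrow> norm b = 1" "\<And>b. b \<in> B \<Longrightarrow> \<exists>c. ?f b = c *\<^sub>R b"
    using selfadjoint_orthonormal_eigenbasis[of ?f UNIV] sa matrix_vector_mul_linear by auto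
  \<comment> \<open>The eigenvalue of a unit eigenvector, written as a Rayleigh quotient to read off its sign.\<close>
  define ev where "ev b = b \<bullet> ?f b" for b
  have ev: "?f b = ev b *\<^sub>R b" if b: "b \<in> B" for b
  proof -
    obtain c where c: "?f b = c *\<^sub>R b" using B(5)[OF b] by blast
    then show ?thesis using B(4)[OF b] by (simp add: ev_def dot_square_norm)
  qed
  have ev0: "0 \<le> ev b" for b using psd by (simp add: ev_def)
  define g where "g v = (\<Sum>b\<in>B. (sqrt (ev b) * (b \<bullet> v)) *\<^sub>R b)" for v
  have g: "linear g"
    unfolding g_def
    by (rule linearI) (simp_all add: inner_add_right algebra_simps sum.distrib scaleR_sum_right)
  have gb: "g b = sqrt (ev b) *\<^sub>R b" if b: "b \<in> B" for b
  proof -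
    have "(\<Sum>a\<in>B. (sqrt (ev a) * (a \<bullet> b)) *\<^sub>R a) = (\<Sum>a\<in>B. if a = b then sqrt (ev b) *\<^sub>R b else 0)"
      using B(3,4) b by (intro sum.cong refl) (auto simp: pairwise_def orthogonal_def dot_square_norm)
    then show ?thesis using b B(1) by (simp add: g_def)
  qed
  have gsa: "g x \<bullet> y = x \<bullet> g y" for x y
    unfolding g_def by (simp add: inner_sum_left inner_sum_right ac_simps inner_commute)
  have gpos: "0 \<le> v \<bullet> g v" for v
  proof -
    have "v \<bullet> g v = (\<Sum>b\<in>B. sqrt (ev b) * (b \<bullet> v)\<^sup>2)"
      unfolding g_def by (simp add: inner_sum_right power2_eq_square ac_simps inner_commute)
    then show ?thesis using ev0 by (simp add: sum_nonneg)
  qed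
  have gg: "g (g x) = ?f x" for x
  proof -
    have "(g \<circ> g) x = ?f x"
    proof (rule linear_eq_on[where f = "g \<circ> g" and g = ?f and x = x and B = B])
      show "x \<in> span B" using B(2) by auto
      show "(g \<circ> g) b = ?f b" if "b \<in> B" for b
        using that ev0[of b] by (simp add: gb ev linear_cmul[OF g])
    qed (auto intro: linear_compose g matrix_vector_mul_linear)
    then show ?thesis by simp
  qed
  let ?R = "matrix g"
  have R: "?R *v x = g x" for x by (simp add: g matrix_works linear_matrix_vector_mul_eq)
  have "sym_tensor ?R"
    unfolding sym_tensor_def
  proof (rule matrix_eq[THEN iffD2], rule allI, rule vector_eq_ldot[THEN iffD1], rule allI)
    fix x y :: "real^3"
    have "x \<bullet> (transpose ?R *v y) = (?R *v x) \<bullet> y"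
      by (metis dot_lmul_matrix inner_commute transpose_matrix_vector)
    then show "x \<bullet> (transpose ?R *v y) = x \<bullet> (?R *v y)" by (simp add: R gsa)
  qed
  moreover have "?R ** ?R = A"
    by (rule matrix_eq[THEN iffD2]) (simp add: R gg flip: matrix_vector_mul_assoc)
  ultimately show ?thesis using gpos by (intro exI[of _ ?R]) (simp add: R)
qed

text \<open>
  This identity replaces \<open>\<parallel>\<kappa>\<^sup>-\<^sup>1\<^sup>/\<^sup>2 z\<parallel>\<^sup>2\<close> by the form \<open>(\<kappa>\<^sup>-\<^sup>1 z) \<bullet> z\<close> that comes from Darcy's law.
  It holds pointwise and thus passes to the integrals without measurability of the root.
\<close>

lemma norm_psd_sqrt:
  assumes sym: "sym_tensor A" and psd: "\<And>v. 0 \<le> v \<bullet> (A *v v)"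
  shows "(psd_sqrt A *v v) \<bullet> (psd_sqrt A *v v) = (A *v v) \<bullet> v"
proof -
  have R: "sym_tensor (psd_sqrt A)" "psd_sqrt A ** psd_sqrt A = A"
    using someI_ex[OF psd_sqrt_exists[OF assms]] unfolding psd_sqrt_def by blast+
  have "(psd_sqrt A *v v) \<bullet> (psd_sqrt A *v v) = (psd_sqrt A *v (psd_sqrt A *v v)) \<bullet> v"
    using R(1) by (metis dot_lmul_matrix sym_tensor_def transpose_matrix_vector)
  then show ?thesis by (simp add: R(2) matrix_vector_mul_assoc)
qed



section \<open>Inverses of coercive matrices\<close>

lemma coercive_invertible:
  fixes A :: "real^'n^'n"
  assumes c: "0 < c" "\<And>v. c * (v \<bullet> v) \<le> v \<bullet> (A *v v)"
  shows "invertible A"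
proof -
  have "x = 0" if "A *v x = 0" for x
  proof -
    have "x \<bullet> x \<le> 0" using c(1) c(2)[of x] that by (simp add: mult_le_0_iff)
    then show ?thesis by (metis inner_eq_zero_iff inner_ge_zero order_antisym)
  qed
  then show ?thesis unfolding invertible_left_inverse matrix_left_invertible_ker by blast
qed

lemma matrix_inv_mult:
  fixes A :: "real^'n^'n"
  assumes "invertible A"
  shows "A ** matrix_inv A = mat 1" "matrix_inv A ** A = mat 1"
  using someI_ex[OF assms[unfolded invertible_def]] unfolding matrix_inv_def by blast+

text \<open>
  With \<open>y = A\<^sup>-\<^sup>1 v\<close>, coercivity reads \<open>c \<parallel>y\<parallel>\<^sup>2 \<le> y \<bullet> v\<close>.  This is positivity of the inverse and, by the
  Cauchy--Schwarz inequality, the bound of its norm.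
\<close>

lemma coercive_matrix_inv:
  fixes A :: "real^'n^'n"
  assumes c: "0 < c" "\<And>v. c * (v \<bullet> v) \<le> v \<bullet> (A *v v)"
  shows "0 \<le> v \<bullet> (matrix_inv A *v v)" "norm (matrix_inv A *v v) \<le> 1 / c * norm v"
proof -
  define y where "y = matrix_inv A *v v"
  have v: "A *v y = v"
    using matrix_inv_mult(1)[OF coercive_invertible[OF c]]
    by (simp add: y_def matrix_vector_mul_assoc)
  have *: "c * (norm y * norm y) \<le> y \<bullet> v" using c(2)[of y] by (simp add: v dot_square_norm power2_eq_square)
  moreover have "0 \<le> c * (norm y * norm y)" using c(1) by simp
  ultimately show "0 \<le> v \<bullet> (matrix_inv A *v v)" by (simp add: y_def inner_commute)
  have "norm y * (c * norm y) \<le> norm y * norm v" using * norm_cauchy_schwarz[of y v] by (simp add: ac_simps)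
  then have "c * norm y \<le> norm v" by (cases "y = 0") auto
  then show "norm (matrix_inv A *v v) \<le> 1 / c * norm v"
    using c(1) by (simp add: field_simps flip: y_def)
qed

lemma sym_tensor_matrix_inv:
  assumes "invertible A" "sym_tensor A"
  shows "sym_tensor (matrix_inv A)"
proof -
  note inv = matrix_inv_mult[OF assms(1)]
  have "transpose (matrix_inv A) ** A = mat 1"
    using arg_cong[OF inv(1), of transpose] assms(2)
    by (simp add: matrix_transpose_mul sym_tensor_def)
  then have "transpose (matrix_inv A) ** (A ** matrix_inv A) = matrix_inv A"
    by (simp add: matrix_mul_assoc)
  then show ?thesis by (simp add: inv(1) sym_tensor_def)
qed

text \<open>
  Cramer's rule expresses the inverse by determinants, that is, by measurable functions of the entries.
\<close>

lemma matrix_inv_vector_cramer: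
  fixes A :: "real^'n^'n"
  assumes "invertible A"
  shows "matrix_inv A *v b = (\<chi> k. det (\<chi> i j. if j = k then b $ i else A $ i $ j) / det A)"
proof -
  have "A *v (matrix_inv A *v b) = b"
    using matrix_inv_mult(1)[OF assms] by (simp add: matrix_vector_mul_assoc)
  then show ?thesis using cramer[of A "matrix_inv A *v b" b] assms by (simp add: invertible_det_nz)
qed



section \<open>Compliance of an elasticity tensor\<close>

lemma linear_tapply: "linear (tapply D)"
  unfolding tapply_def by (rule linearI) (simp_all add: vec_eq_iff inner_add_right)

lemma transpose_add: "transpose (A + B) = transpose A + transpose B"
  by (simp add: transpose_def vec_eq_iff)

lemma subspace_sym_tensor: "subspace (Collect sym_tensor)"
  unfolding subspace_def sym_tensor_def by (auto simp: transpose_add transpose_scalar) (simp add: transpose_def zero_vec_def)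

lemma sym_tensor_tapply:
  assumes "elasticity_tensor D"
  shows "sym_tensor (tapply D e)"
proof -
  have "D $ i $ j $ k $ l = D $ j $ i $ k $ l" for i j k l
    using assms unfolding elasticity_tensor_def by blast
  then have sw: "D $ i $ j = D $ j $ i" for i j by (simp add: vec_eq_iff)
  have "transpose (tapply D e) $ i $ j = tapply D e $ i $ j" for i j
    by (simp add: tapply_def transpose_def sw[of j i])
  then show ?thesis by (simp add: sym_tensor_def vec_eq_iff)
qed

text \<open>
  Positive definiteness makes the map injective on symmetric tensors, and it maps this
  finite-dimensional space into itself; hence it is also onto.
\<close>

lemma elasticity_bij:
  assumes D: "elasticity_tensor D" and s: "sym_tensor s"
  shows "\<exists>!e. sym_tensor e \<and> tapply D e = s"
proof -
  let ?S = "Collect sym_tensor"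
  have inj: "inj_on (tapply D) ?S"
  proof (rule inj_onI, rule ccontr)
    fix x y assume xy: "x \<in> ?S" "y \<in> ?S" "tapply D x = tapply D y" "x \<noteq> y"
    then have "sym_tensor (x - y)" using subspace_diff[OF subspace_sym_tensor, of x y] by simp
    then have "0 < (x - y) \<bullet> tapply D (x - y)" using D xy(4) unfolding elasticity_tensor_def by simp
    then show False using xy(3) by (simp add: linear_diff[OF linear_tapply])
  qed
  have "tapply D ` ?S = ?S"
  proof (rule subspace_dim_equal)
    show "subspace (tapply D ` ?S)" by (rule linear_subspace_image[OF linear_tapply subspace_sym_tensor])
    show "tapply D ` ?S \<subseteq> ?S" using sym_tensor_tapply[OF D] by auto
    have "dim (tapply D ` ?S) = dim ?S"
      by (rule dim_image_eq[OF linear_tapply]) (metis inj span_eq_iff subspace_sym_tensor)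
    then show "dim ?S \<le> dim (tapply D ` ?S)" by simp
  qed (rule subspace_sym_tensor)
  then have "s \<in> tapply D ` ?S" using s by simp
  then obtain e where "sym_tensor e" "s = tapply D e" by auto
  then show ?thesis using inj unfolding inj_on_def by (intro ex1I[of _ e]) auto
qed

lemma compliance:
  assumes "elasticity_tensor D" "sym_tensor s"
  shows "sym_tensor (compliance D s)" "tapply D (compliance D s) = s"
  using theI'[OF elasticity_bij[OF assms]] unfolding compliance_def by blast+

lemma compliance_diff:
  assumes D: "elasticity_tensor D" and s: "sym_tensor s" "sym_tensor t"
  shows "compliance D (s - t) = compliance D s - compliance D t"
proof -
  let ?e = "compliance D s - compliance D t"
  have "sym_tensor (s - t)" "sym_tensor ?e"
    using subspace_diff[OF subspace_sym_tensor] s compliance(1)[OF D] by auto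
  moreover have "tapply D ?e = s - t"
    by (simp add: linear_diff[OF linear_tapply] compliance(2)[OF D] s)
  ultimately show ?thesis
    using compliance[OF D] elasticity_bij[OF D, of "s - t"] by blast
qed

lemma compliance_nonneg:
  assumes D: "elasticity_tensor D" and s: "sym_tensor s"
  shows "0 \<le> s \<bullet> compliance D s"
proof (cases "compliance D s = 0")
  case False
  then have "0 < compliance D s \<bullet> tapply D (compliance D s)"
    using D compliance(1)[OF assms] unfolding elasticity_tensor_def by simp
  then show ?thesis by (simp add: compliance(2)[OF assms] inner_commute)
qed simp


section \<open>Square-integrable fields\<close>

lemma L2_dominated:
  fixes f :: "'a \<Rightarrow> 'b::euclidean_space" and g :: "'a \<Rightarrow> 'c::euclidean_space"
  assumes f: "f \<in> borel_measurable M" and g: "L2 M g"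
    and bound: "\<And>x. x \<in> space M \<Longrightarrow> norm (f x) \<le> c * norm (g x)"
  shows "L2 M f"
proof -
  have "integrable M (\<lambda>x. c\<^sup>2 * (norm (g x))\<^sup>2)" using g by (simp add: L2_def)
  then have "integrable M (\<lambda>x. (norm (f x))\<^sup>2)"
  proof (rule Bochner_Integration.integrable_bound)
    show "AE x in M. norm ((norm (f x))\<^sup>2) \<le> norm (c\<^sup>2 * (norm (g x))\<^sup>2)"
      using power_mono[OF bound, of _ 2] by (intro AE_I2) (simp add: power_mult_distrib)
  qed (use f in measurable)
  then show ?thesis using f by (simp add: L2_def)
qed

lemma L2_add:
  fixes f g :: "'a \<Rightarrow> 'b::euclidean_space"
  assumes f: "L2 M f" and g: "L2 M g"
  shows "L2 M (\<lambda>x. f x + g x)"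
proof -
  have [measurable]: "f \<in> borel_measurable M" "g \<in> borel_measurable M" using f g by (auto simp: L2_def)
  have "integrable M (\<lambda>x. 2 * (norm (f x))\<^sup>2 + 2 * (norm (g x))\<^sup>2)" using f g by (simp add: L2_def)
  then have "integrable M (\<lambda>x. (norm (f x + g x))\<^sup>2)"
  proof (rule Bochner_Integration.integrable_bound)
    have "(norm (a + b))\<^sup>2 \<le> 2 * (norm a)\<^sup>2 + 2 * (norm b)\<^sup>2" for a b :: 'b
      using zero_le_power2[of "norm (a - b)"]
      by (simp add: power2_norm_eq_inner inner_add_left inner_add_right inner_diff_left inner_diff_right inner_commute)
    then show "AE x in M. norm ((norm (f x + g x))\<^sup>2) \<le> norm (2 * (norm (f x))\<^sup>2 + 2 * (norm (g x))\<^sup>2)"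
      by (intro AE_I2) simp
  qed measurable
  then show ?thesis by (simp add: L2_def)
qed

lemma L2_scaleR:
  assumes "L2 M f"
  shows "L2 M (\<lambda>x. c *\<^sub>R f x)"
  by (rule L2_dominated[OF _ assms, where c = "\<bar>c\<bar>"]) (use assms in \<open>auto simp: L2_def\<close>)

lemma L2_diff:
  assumes "L2 M f" "L2 M g"
  shows "L2 M (\<lambda>x. f x - g x)"
  using L2_add[OF assms(1) L2_scaleR[OF assms(2), of "-1"]] by simp

text \<open>
  Lebesgue measure is complete, so measurability passes to functions that agree almost everywhere.
  This applies to \<open>D\<^sup>-\<^sup>1 \<delta>\<sigma>\<close> and to symmetric gradients, which are known only through almost everywhere
  identities.
\<close>

lemma L2_cong_AE:
  fixes f g :: "'a::euclidean_space \<Rightarrow> 'b::euclidean_space"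
  assumes \<Omega>: "\<Omega> \<in> sets lebesgue" and f: "L2 (lebesgue_on \<Omega>) f"
    and eq: "AE x in lebesgue_on \<Omega>. f x = g x"
  shows "L2 (lebesgue_on \<Omega>) g"
proof -
  let ?e = "\<lambda>f x. if x \<in> \<Omega> then f x else 0 :: 'b"
  have "?e f \<in> borel_measurable lebesgue" using f \<Omega> by (simp add: borel_measurable_if L2_def)
  moreover have "AE x in lebesgue. ?e f x = ?e g x"
    using eq \<Omega> by (simp add: AE_restrict_space_iff)
  ultimately have "?e g \<in> borel_measurable lebesgue" by (rule borel_measurable_AE)
  then have [measurable]: "g \<in> borel_measurable (lebesgue_on \<Omega>)" using \<Omega> by (simp add: borel_measurable_if)
  have "integrable (lebesgue_on \<Omega>) (\<lambda>x. (norm (g x))\<^sup>2)"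
    by (rule integrable_cong_AE_imp[of _ "\<lambda>x. (norm (f x))\<^sup>2"])
       (use f eq in \<open>auto simp: L2_def elim: eventually_mono\<close>)
  then show ?thesis by (simp add: L2_def)
qed

lemma L2_integrable_inner:
  assumes f: "L2 M f" and g: "L2 M g"
  shows "integrable M (\<lambda>x. f x \<bullet> g x)"
proof -
  have [measurable]: "f \<in> borel_measurable M" "g \<in> borel_measurable M" using f g by (auto simp: L2_def)
  have "integrable M (\<lambda>x. (norm (f x))\<^sup>2 + (norm (g x))\<^sup>2)" using f g by (simp add: L2_def)
  then show ?thesis
  proof (rule Bochner_Integration.integrable_bound)
    have "\<bar>a \<bullet> b\<bar> \<le> (norm a)\<^sup>2 + (norm b)\<^sup>2" for a b :: 'b
    proof -
      have "\<bar>a \<bullet> b\<bar> \<le> norm a * norm b" by (rule Cauchy_Schwarz_ineq2)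
      also have "\<dots> \<le> (norm a)\<^sup>2 + (norm b)\<^sup>2"
        using sum_squares_bound[of "norm a" "norm b"] zero_le_mult_iff[of "norm a" "norm b"] norm_ge_zero[of a] norm_ge_zero[of b] by linarith
      finally show ?thesis .
    qed
    then show "AE x in M. norm (f x \<bullet> g x) \<le> norm ((norm (f x))\<^sup>2 + (norm (g x))\<^sup>2)"
      by (intro AE_I2) simp
  qed measurable
qed

lemma L2_bounded_inner:
  assumes B: "bounded_field \<Omega> B" and f: "L2 (lebesgue_on \<Omega>) f"
  shows "L2 (lebesgue_on \<Omega>) (\<lambda>x. B x \<bullet> f x)"
proof -
  have [measurable]: "B \<in> borel_measurable (lebesgue_on \<Omega>)" "f \<in> borel_measurable (lebesgue_on \<Omega>)"
    using B f by (auto simp: L2_def bounded_field_def)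
  obtain c where c: "\<And>x. x \<in> \<Omega> \<Longrightarrow> norm (B x) \<le> c"
    using B unfolding bounded_field_def bounded_iff by auto
  show ?thesis
  proof (rule L2_dominated[OF _ f])
    show "norm (B x \<bullet> f x) \<le> c * norm (f x)" if "x \<in> space (lebesgue_on \<Omega>)" for x
      using Cauchy_Schwarz_ineq2[of "B x" "f x"] mult_right_mono[OF c[of x] norm_ge_zero[of "f x"]] that
      by simp
  qed measurable
qed

lemma L2_scaleR_bounded:
  fixes f :: "_ \<Rightarrow> real"
  assumes B: "bounded_field \<Omega> B" and f: "L2 (lebesgue_on \<Omega>) f"
  shows "L2 (lebesgue_on \<Omega>) (\<lambda>x. f x *\<^sub>R B x)"
proof -
  have [measurable]: "B \<in> borel_measurable (lebesgue_on \<Omega>)" "f \<in> borel_measurable (lebesgue_on \<Omega>)"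
    using B f by (auto simp: L2_def bounded_field_def)
  obtain c where c: "\<And>x. x \<in> \<Omega> \<Longrightarrow> norm (B x) \<le> c"
    using B unfolding bounded_field_def bounded_iff by auto
  show ?thesis
  proof (rule L2_dominated[OF _ f])
    show "norm (f x *\<^sub>R B x) \<le> c * norm (f x)" if "x \<in> space (lebesgue_on \<Omega>)" for x
      using mult_right_mono[OF c[of x] norm_ge_zero[of "f x"]] that by (simp add: mult.commute)
  qed measurable
qed


lemma l2ip_commute: "l2ip M f g = l2ip M g f"
  by (simp add: l2ip_def inner_commute)

lemma l2ip_add_left:
  assumes "L2 M f" "L2 M g" "L2 M h"
  shows "l2ip M (\<lambda>x. f x + g x) h = l2ip M f h + l2ip M g h"
  using assms by (simp add: l2ip_def inner_add_left L2_integrable_inner)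

lemma l2ip_diff_left:
  assumes "L2 M f" "L2 M g" "L2 M h"
  shows "l2ip M (\<lambda>x. f x - g x) h = l2ip M f h - l2ip M g h"
  using assms by (simp add: l2ip_def inner_diff_left L2_integrable_inner)

lemma l2ip_scaleR_left: "l2ip M (\<lambda>x. c *\<^sub>R f x) h = c * l2ip M f h"
  by (simp add: l2ip_def)

lemma l2ip_diff_right:
  assumes "L2 M f" "L2 M g" "L2 M h"
  shows "l2ip M h (\<lambda>x. f x - g x) = l2ip M h f - l2ip M h g"
  using l2ip_diff_left[OF assms] by (simp add: l2ip_commute)

lemma l2ip_cong_AE:
  assumes "L2 M f" "L2 M f'" "L2 M g" "L2 M g'" "AE x in M. f x = f' x" "AE x in M. g x = g' x"
  shows "l2ip M f g = l2ip M f' g'"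
  unfolding l2ip_def using assms
  by (intro integral_cong_AE) (auto simp: L2_def elim: eventually_elim2)

lemma l2norm_square: "(l2norm M f)\<^sup>2 = l2ip M f f"
  unfolding l2norm_def l2ip_def by (simp add: integral_nonneg_AE)

lemma l2ip_self_nonneg: "0 \<le> l2ip M f f"
  unfolding l2ip_def by (simp add: integral_nonneg_AE)

text \<open>
  Young's inequality with weights 1/2, obtained from \<open>0 \<le> \<parallel>f + g\<parallel>\<^sup>2\<close>.
\<close>

lemma l2ip_young:
  assumes f: "L2 M f" and g: "L2 M g"
  shows "- l2ip M f g \<le> 1/2 * l2ip M f f + 1/2 * l2ip M g g"
proof -
  have "0 \<le> l2ip M (\<lambda>x. f x + g x) (\<lambda>x. f x + g x)" by (rule l2ip_self_nonneg)
  also have "\<dots> = l2ip M f f + 2 * l2ip M f g + l2ip M g g"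
    using l2ip_commute[of M f "\<lambda>x. f x + g x"] l2ip_commute[of M g "\<lambda>x. f x + g x"] l2ip_commute[of M g f]
    by (simp add: l2ip_add_left L2_add f g)
  finally show ?thesis by simp
qed

lemma l2ip_lincomb_left:
  fixes f g h :: "'a \<Rightarrow> real"
  assumes f: "L2 M f" and g: "L2 M g" and h: "L2 M h"
  shows "l2ip M (\<lambda>x. c * f x + d * g x) h = c * l2ip M f h + d * l2ip M g h"
  using l2ip_add_left[OF L2_scaleR[OF f, of c] L2_scaleR[OF g, of d] h]
    l2ip_scaleR_left[of M c f h] l2ip_scaleR_left[of M d g h] by simp

lemma l2ip_lincomb_square:
  fixes f g :: "'a \<Rightarrow> real"
  assumes f: "L2 M f" and g: "L2 M g"
  shows "l2ip M (\<lambda>x. c * f x + d * g x) (\<lambda>x. c * f x + d * g x)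
    = c\<^sup>2 * l2ip M f f + 2 * c * d * l2ip M f g + d\<^sup>2 * l2ip M g g"
proof -
  let ?u = "\<lambda>x. c * f x + d * g x"
  have u: "L2 M ?u" using L2_add[OF L2_scaleR[OF f, of c] L2_scaleR[OF g, of d]] by simp
  show ?thesis
    using l2ip_lincomb_left[OF f g u, of c d] l2ip_lincomb_left[OF f g f, of c d]
      l2ip_lincomb_left[OF f g g, of c d] l2ip_commute[of M f ?u] l2ip_commute[of M g ?u] l2ip_commute[of M g f]
    by (simp add: algebra_simps power2_eq_square)
qed


lemma borel_measurable_vec_nth:
  fixes f :: "'a \<Rightarrow> 'b::euclidean_space^'n"
  assumes "f \<in> borel_measurable M"
  shows "(\<lambda>x. f x $ i) \<in> borel_measurable M"
  by (rule borel_measurable_continuous_on[OF _ assms]) (intro continuous_intros)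

lemma borel_measurable_vec_lambda:
  fixes f :: "'a \<Rightarrow> 'n::finite \<Rightarrow> real"
  assumes "\<And>i. (\<lambda>x. f x i) \<in> borel_measurable M"
  shows "(\<lambda>x. \<chi> i. f x i) \<in> borel_measurable M"
  unfolding borel_measurable_euclidean_space[of "\<lambda>x. \<chi> i. f x i"]
proof
  fix b :: "real^'n" assume "b \<in> Basis"
  then obtain i where "b = axis i 1" by (auto simp: Basis_vec_def)
  then show "(\<lambda>x. (\<chi> i. f x i) \<bullet> b) \<in> borel_measurable M" using assms[of i] by (simp add: inner_axis)
qed

lemma borel_measurable_det:
  fixes A :: "'a \<Rightarrow> real^'n^'n"
  assumes "\<And>i j. (\<lambda>x. A x $ i $ j) \<in> borel_measurable M"
  shows "(\<lambda>x. det (A x)) \<in> borel_measurable M"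
  unfolding det_def
  by (intro borel_measurable_sum borel_measurable_times borel_measurable_const borel_measurable_prod assms)

lemma borel_measurable_matrix_inv_vector:
  fixes A :: "'a \<Rightarrow> real^'n^'n"
  assumes meas: "A \<in> borel_measurable M" "f \<in> borel_measurable M"
    and inv: "\<And>x. x \<in> space M \<Longrightarrow> invertible (A x)"
  shows "(\<lambda>x. matrix_inv (A x) *v f x) \<in> borel_measurable M"
proof -
  have A: "(\<lambda>x. A x $ i $ j) \<in> borel_measurable M" for i j
    by (rule borel_measurable_vec_nth, rule borel_measurable_vec_nth, rule meas)
  have f: "(\<lambda>x. f x $ i) \<in> borel_measurable M" for i
    by (rule borel_measurable_vec_nth, rule meas)
  have "(\<lambda>x. (\<chi> i j. if j = k then f x $ i else A x $ i $ j) $ i $ j) \<in> borel_measurable M" for i j k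
    using A f by (cases "j = k") simp_all
  then have "(\<lambda>x. \<chi> k. det (\<chi> i j. if j = k then f x $ i else A x $ i $ j) / det (A x)) \<in> borel_measurable M"
    by (rule borel_measurable_vec_lambda[OF borel_measurable_divide[OF borel_measurable_det borel_measurable_det[OF A]]])
  moreover have "(\<chi> k. det (\<chi> i j. if j = k then f x $ i else A x $ i $ j) / det (A x)) = matrix_inv (A x) *v f x"
    if "x \<in> space M" for x
    by (rule matrix_inv_vector_cramer[OF inv[OF that], symmetric])
  ultimately show ?thesis using measurable_cong[of M] by (metis (no_types, lifting))
qed


section \<open>Two consecutive coupling iterations\<close>

text \<open>
  The states \<open>s0\<close>, \<open>s1\<close>, \<open>s2\<close> are three successive iterates.  The state \<open>s0\<close> may be an
  initial guess that solves none of the equations; its stress must be square integrable because it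
  enters the mass balance of \<open>s1\<close>.
\<close>

locale consecutive_iterations =
  fixes P :: poro_problem and sn s0 h0 s1 h s2 :: poro_state
  assumes data: "wellposed_data P"
    and sn: "L2 (leb P) (pressure sn)" "L2 (leb P) (stress sn)" "L2 (leb P) (pporosity sn)"
    and s0: "L2 (leb P) (stress s0)"
    and it1: "coupling_iteration P sn s0 h0 s1"
    and it2: "coupling_iteration P sn s1 h s2"
begin

abbreviation "M \<equiv> leb P"
abbreviation "C \<equiv> hooke P"
abbreviation "B \<equiv> skempton P"

text \<open>The operators \<open>d\<close> and \<open>dp\<close> are \<open>\<delta>\<^sup>(\<^sup>k\<^sup>)\<close> and \<open>\<delta>\<^sub>p\<^sup>(\<^sup>k\<^sup>)\<close>; \<open>b\<close> and \<open>b0\<close> are \<open>B : \<delta>\<sigma>\<close> over the current and the previous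
  iteration.\<close>

abbreviation "d X \<equiv> (\<lambda>x. X s2 x - X s1 x)"
abbreviation "dp X \<equiv> (\<lambda>x. X s2 x - X h x)"
abbreviation "b \<equiv> (\<lambda>x. B x \<bullet> d stress x)"
abbreviation "b0 \<equiv> (\<lambda>x. B x \<bullet> (stress s1 x - stress s0 x))"
abbreviation "Kinv x \<equiv> matrix_inv (kappa P x)"

lemma dom_sets: "dom P \<in> sets lebesgue"
  using data by (auto simp: wellposed_data_def)

lemma pos: "0 < C" "0 < tstep P"
  using data by (auto simp: wellposed_data_def)

lemma AE_domI: "(\<And>x. x \<in> dom P \<Longrightarrow> Q x) \<Longrightarrow> AE x in M. Q x"
  by (intro AE_I2) simp

lemma fields: "bounded_field (dom P) B" "bounded_field (dom P) (biot P)"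
    "bounded_field (dom P) (beta P)"
  using data by (auto simp: wellposed_data_def)

lemma s1_s2_L2: 
  assumes "s \<in> {s1, s2}"
  shows "L2 M (pressure s)" "L2 M (flux s)" "L2 M (estrain s)" "L2 M (pstrain s)"
     "L2 M (stress s)" "L2 M (pporosity s)" "L2 M (fcontent s)"
  using assms it1 it2 by (auto simp: coupling_iteration_def square_integrable_state_def)

lemmas L2_s1 = s1_s2_L2[of s1, simplified] and L2_s2 = s1_s2_L2[of s2, simplified]

lemma L2_h: "L2 M (estrain h)" "L2 M (pporosity h)" "L2 M (fcontent h)" "L2 M (pstrain h)"
  using it2 by (auto simp: coupling_iteration_def square_integrable_state_def)

lemma L2_d:
  "L2 M (d pressure)" "L2 M (d flux)" "L2 M (d estrain)"
  "L2 M (d stress)" "L2 M (d pporosity)" "L2 M (d fcontent)"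
  "L2 M (\<lambda>x. stress s1 x - stress s0 x)"
  by (intro L2_diff L2_s1 L2_s2 s0)+

lemma L2_b: "L2 M b" "L2 M b0"
  by (intro L2_bounded_inner fields L2_d)+

lemma W: "pressure s1 \<in> W_h P" "pressure s2 \<in> W_h P"
  and V: "flux s1 \<in> V_h P" "flux s2 \<in> V_h P"
  and U: "displ s1 \<in> U_h P" "displ s2 \<in> U_h P"
  using it1 it2 by (auto simp: coupling_iteration_def)

lemma L2_wdiv: "L2 M (wdiv (dom P) (flux s1))" "L2 M (wdiv (dom P) (flux s2))"
  using V someI_ex[of "has_weak_div (dom P) (flux s1)"] someI_ex[of "has_weak_div (dom P) (flux s2)"]
  by (auto simp: V_h_def H_div_def wdiv_def has_weak_div_def)

lemma constitutive: "constitutive P s1" "constitutive P s2" "constitutive P h"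
  using it1 it2 by (auto simp: coupling_iteration_def)

lemma fcontent_change:
  "AE x in M. d fcontent x = C * d pressure x + C / 3 * b x + d pporosity x"
proof -
  have eq: "AE x in M. fcontent s x = C * pressure s x + C / 3 * (B x \<bullet> stress s x) + pporosity s x"
    if "constitutive P s" for s
    using that unfolding constitutive_def by (rule eventually_mono) blast
  show ?thesis
    using eq[OF constitutive(1)] eq[OF constitutive(2)]
    by eventually_elim (simp add: inner_diff_right algebra_simps)
qed

lemma elasticity: "AE x in M. elasticity_tensor (elasticity P x)"
  using data by (intro AE_domI) (auto simp: wellposed_data_def)

lemma stress_sym: "AE x in M. sym_tensor (stress s1 x) \<and> sym_tensor (stress s2 x)"
  using constitutive(1,2) unfolding constitutive_def by eventually_elim blast

lemma estrain_change:
  "AE x in M. compliance (elasticity P x) (d stress x)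
      = d estrain x - (C / 3) *\<^sub>R (d pressure x *\<^sub>R B x)"
proof -
  have eq: "AE x in M. estrain s x = compliance (elasticity P x) (stress s x) + (C / 3 * pressure s x) *\<^sub>R B x"
    if "constitutive P s" for s
    using that unfolding constitutive_def by (rule eventually_mono) blast
  show ?thesis
    using eq[OF constitutive(1)] eq[OF constitutive(2)] elasticity stress_sym
    by eventually_elim (simp add: compliance_diff algebra_simps)
qed

text \<open>
  The poromechanics solve starts with the new pressure, and with the stress and the plastic strain of the
  old iterate.  Hence its changes of \<open>\<sigma>\<close> and \<open>\<epsilon>\<^sup>p\<close> are those of the whole iteration, its change of \<open>p\<close>
  vanishes, and the two formulas for \<open>\<zeta>\<close> give \<open>C/3 b\<close> and \<open>\<alpha> : \<delta>\<^sub>p\<epsilon>\<^sup>e\<close> as the value of \<open>\<delta>\<^sub>p\<zeta> - \<delta>\<^sub>p\<phi>\<close>.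
\<close>

lemma mechanics_change:
  "AE x in M. dp fcontent x - dp pporosity x = C / 3 * b x"
  "AE x in M. biot P x \<bullet> dp estrain x = C / 3 * b x"
  "AE x in M. beta P x \<bullet> dp pstrain x = d pporosity x"
proof -
  have frozen: "AE x in M. stress h x = stress s1 x \<and> pstrain h x = pstrain s1 x"
      "AE x in M. pressure s2 x = pressure h x"
    using it2 by (auto simp: coupling_iteration_def)
  have eq:
    "AE x in M. fcontent s x = C * pressure s x + C / 3 * (B x \<bullet> stress s x) + pporosity s x"
    "AE x in M. fcontent s x = pressure s x / biot_modulus P + biot P x \<bullet> estrain s x + pporosity s x"
    "AE x in M. pporosity s x = beta P x \<bullet> pstrain s x"
    if "constitutive P s" for s
    using that unfolding constitutive_def by (auto elim!: eventually_mono)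
  show 1: "AE x in M. dp fcontent x - dp pporosity x = C / 3 * b x"
    using frozen eq(1)[OF constitutive(2)] eq(1)[OF constitutive(3)]
    by eventually_elim (simp add: inner_diff_right algebra_simps)
  show "AE x in M. biot P x \<bullet> dp estrain x = C / 3 * b x"
    using 1 frozen eq(2)[OF constitutive(2)] eq(2)[OF constitutive(3)]
    by eventually_elim (simp add: inner_diff_right)
  show "AE x in M. beta P x \<bullet> dp pstrain x = d pporosity x"
    using frozen eq(3)[OF constitutive(1)] eq(3)[OF constitutive(2)] eq(3)[OF constitutive(3)]
    by eventually_elim (simp add: inner_diff_right)
qed

text \<open>
  The source and the state at the previous time step cancel; the stress of this equation lags by one
  iteration, whence \<open>b0\<close> on the right.
\<close>

lemma mass_balance_change:
  assumes th: "th \<in> W_h P"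
  shows "C * l2ip M (d pressure) th
       + tstep P * l2ip M (\<lambda>x. wdiv (dom P) (flux s2) x - wdiv (dom P) (flux s1) x) th
       + l2ip M (d pporosity) th = - (C / 3 * l2ip M b0 th)"
proof -
  have th2: "L2 M th" using th by (simp add: W_h_def)
  have Bs: "L2 M (\<lambda>x. B x \<bullet> (s x - stress sn x))" if "L2 M s" for s
    by (intro L2_bounded_inner fields L2_diff sn that)
  have 0: "b0 = (\<lambda>x. B x \<bullet> (stress s1 x - stress sn x) - B x \<bullet> (stress s0 x - stress sn x))"
    by (simp add: inner_diff_right)
  have b0: "l2ip M b0 th = l2ip M (\<lambda>x. B x \<bullet> (stress s1 x - stress sn x)) th
      - l2ip M (\<lambda>x. B x \<bullet> (stress s0 x - stress sn x)) th"
    unfolding 0 by (intro l2ip_diff_left Bs L2_s1 s0 th2)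
  have "mass_balance P sn (pressure s1) (flux s1) (pporosity s1) (stress s0)"
    "mass_balance P sn (pressure s2) (flux s2) (pporosity s2) (stress s1)"
    using it1 it2 by (auto simp: coupling_iteration_def)
  from this[unfolded mass_balance_def, rule_format, OF th] show ?thesis
    unfolding b0
    by (simp add: l2ip_diff_left L2_s1 L2_s2 sn L2_wdiv th2 algebra_simps)
qed

text \<open>
  Dividing the uniform ellipticity of the permeability by the viscosity.
\<close>

lemma kappa_coercive:
  obtains c where "0 < c" "\<And>x v. x \<in> dom P \<Longrightarrow> c * (v \<bullet> v) \<le> v \<bullet> (kappa P x *v v)"
proof -
  obtain c where c: "0 < c" "\<And>x v. x \<in> dom P \<Longrightarrow> c * (v \<bullet> v) \<le> v \<bullet> (permeability P x *v v)"
    using data unfolding wellposed_data_def uniformly_spd_def by blast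
  have mu: "0 < viscosity P" using data by (simp add: wellposed_data_def)
  show thesis
  proof (rule that[of "c / viscosity P"])
    show "c / viscosity P * (v \<bullet> v) \<le> v \<bullet> (kappa P x *v v)" if "x \<in> dom P" for x v
      using divide_right_mono[OF c(2)[OF that, of v], of "viscosity P"] mu
      by (simp add: kappa_def scaleR_matrix_vector_assoc[symmetric])
  qed (use c mu in simp)
qed

lemma kappa_sym: "x \<in> dom P \<Longrightarrow> sym_tensor (kappa P x)"
  using data by (simp add: wellposed_data_def uniformly_spd_def kappa_def sym_tensor_def transpose_scalar)

lemma L2_Kinv:
  assumes f: "L2 M f"
  shows "L2 M (\<lambda>x. Kinv x *v f x)"
proof -
  obtain c where c: "0 < c" "\<And>x v. x \<in> dom P \<Longrightarrow> c * (v \<bullet> v) \<le> v \<bullet> (kappa P x *v v)"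
    using kappa_coercive by blast
  have "permeability P \<in> borel_measurable M"
    using data by (simp add: wellposed_data_def uniformly_spd_def bounded_field_def)
  then have "kappa P \<in> borel_measurable M" unfolding kappa_def[abs_def] by simp
  then have "(\<lambda>x. Kinv x *v f x) \<in> borel_measurable M"
    using f by (intro borel_measurable_matrix_inv_vector coercive_invertible[OF c]) (auto simp: L2_def)
  then show ?thesis
    by (rule L2_dominated[OF _ f]) (rule coercive_matrix_inv(2)[OF c], simp)
qed

text \<open>
  The boundary and gravity terms cancel for each test function.  The chosen representatives of
  weak divergences are unique only almost everywhere; testing with the two fluxes separately and
  subtracting the results avoids comparing \<open>div (z2 - z1)\<close> with \<open>div z2 - div z1\<close>.
\<close>

lemma darcy_change:
  "l2ip M (\<lambda>x. Kinv x *v d flux x) (d flux)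
     = l2ip M (d pressure) (\<lambda>x. wdiv (dom P) (flux s2) x - wdiv (dom P) (flux s1) x)"
proof -
  have *: "l2ip M (\<lambda>x. Kinv x *v d flux x) v = l2ip M (d pressure) (wdiv (dom P) v)"
    if v: "v \<in> V_h P" "L2 M v" "L2 M (wdiv (dom P) v)" for v
  proof -
    have "darcy P (pressure s1) (flux s1)" "darcy P (pressure s2) (flux s2)"
      using it1 it2 by (auto simp: coupling_iteration_def)
    from this[unfolded darcy_def, rule_format, OF v(1)] show ?thesis
      using v by (simp add: l2ip_diff_left matrix_vector_mult_diff_distrib L2_Kinv L2_s1 L2_s2)
  qed
  show ?thesis
    using *[OF V(1) L2_s1(2) L2_wdiv(1)] *[OF V(2) L2_s2(2) L2_wdiv(2)]
    by (simp add: l2ip_diff_right L2_s1 L2_s2 L2_wdiv L2_d L2_Kinv)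
qed

lemma flux_energy:
  "(l2norm M (\<lambda>x. psd_sqrt (Kinv x) *v d flux x))\<^sup>2 = l2ip M (\<lambda>x. Kinv x *v d flux x) (d flux)"
proof -
  obtain c where c: "0 < c" "\<And>x v. x \<in> dom P \<Longrightarrow> c * (v \<bullet> v) \<le> v \<bullet> (kappa P x *v v)"
    using kappa_coercive by blast
  show ?thesis
    unfolding l2norm_square l2ip_def
  proof (rule Bochner_Integration.integral_cong[OF refl])
    fix x assume "x \<in> space M"
    then have x: "x \<in> dom P" by simp
    have "sym_tensor (Kinv x)"
      using coercive_invertible[OF c(1) c(2)[OF x]] kappa_sym[OF x] by (rule sym_tensor_matrix_inv)
    then show "(psd_sqrt (Kinv x) *v d flux x) \<bullet> (psd_sqrt (Kinv x) *v d flux x)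
        = (Kinv x *v d flux x) \<bullet> d flux x"
      by (rule norm_psd_sqrt) (rule coercive_matrix_inv(1)[OF c(1) c(2)[OF x]])
  qed
qed

text \<open>
  The virtual work of the stress change vanishes for each of the two displacements as test functions, and
  their symmetric gradients are the elastic strains.
\<close>

lemma equilibrium_change: "l2ip M (d stress) (d estrain) = 0"
proof -
  have eq: "AE x in M. estrain s1 x = sym_grad (dom P) (displ s1) x"
    "AE x in M. estrain s2 x = sym_grad (dom P) (displ s2) x"
    "equilibrium P (stress s1)" "equilibrium P (stress s2)"
    using it1 it2 by (auto simp: coupling_iteration_def)
  have *: "l2ip M (d stress) e = 0"
    if q: "q \<in> U_h P" and e: "L2 M e" "AE x in M. e x = sym_grad (dom P) q x" for q e
  proof -
    have g: "L2 M (sym_grad (dom P) q)" by (rule L2_cong_AE[OF dom_sets e])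
    have "l2ip M (d stress) e = l2ip M (d stress) (sym_grad (dom P) q)"
      by (intro l2ip_cong_AE L2_d e g) simp
    also have "\<dots> = 0"
      using eq(3,4)[unfolded equilibrium_def, rule_format, OF q] g
      by (simp add: l2ip_diff_left L2_s1 L2_s2)
    finally show ?thesis .
  qed
  show ?thesis
    using *[OF U(1) L2_s1(3) eq(1)] *[OF U(2) L2_s2(3) eq(2)]
    by (simp add: l2ip_diff_right L2_s1 L2_s2 L2_d)
qed

text \<open>
  The strain change splits into \<open>D\<^sup>-\<^sup>1 \<delta>\<sigma>\<close> and \<open>C/3 p B\<close>; only their sum is orthogonal to the stress change.
\<close>

lemma stress_energy:
  "l2ip M (d stress) (\<lambda>x. compliance (elasticity P x) (d stress x)) = - (C / 3 * l2ip M b (d pressure))"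
proof -
  have pB: "L2 M (\<lambda>x. (C / 3) *\<^sub>R (d pressure x *\<^sub>R B x))"
    by (intro L2_scaleR L2_scaleR_bounded fields L2_d)
  have L2c: "L2 M (\<lambda>x. d estrain x - (C / 3) *\<^sub>R (d pressure x *\<^sub>R B x))"
    by (intro L2_diff[OF L2_d(3) pB])
  have eq: "AE x in M. d estrain x - (C / 3) *\<^sub>R (d pressure x *\<^sub>R B x)
      = compliance (elasticity P x) (d stress x)"
    using estrain_change by eventually_elim simp
  have "l2ip M (d stress) (\<lambda>x. compliance (elasticity P x) (d stress x))
      = l2ip M (d stress) (\<lambda>x. d estrain x - (C / 3) *\<^sub>R (d pressure x *\<^sub>R B x))"
    by (intro l2ip_cong_AE L2_d L2c L2_cong_AE[OF dom_sets L2c eq] estrain_change) simp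
  also have "\<dots> = l2ip M (d stress) (d estrain) - l2ip M (d stress) (\<lambda>x. (C / 3) *\<^sub>R (d pressure x *\<^sub>R B x))"
    by (intro l2ip_diff_right L2_d pB)
  also have "l2ip M (d stress) (\<lambda>x. (C / 3) *\<^sub>R (d pressure x *\<^sub>R B x)) = C / 3 * l2ip M b (d pressure)"
    unfolding l2ip_def integral_mult_right_zero[symmetric]
    by (rule Bochner_Integration.integral_cong) (simp_all add: inner_commute)
  finally show ?thesis by (simp add: equilibrium_change)
qed

lemma stress_energy_nonneg:
  "0 \<le> l2ip M (d stress) (\<lambda>x. compliance (elasticity P x) (d stress x))"
  unfolding l2ip_def
proof (rule integral_nonneg_AE)
  show "AE x in M. 0 \<le> d stress x \<bullet> compliance (elasticity P x) (d stress x)"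
    using elasticity stress_sym
  proof eventually_elim
    case (elim x)
    then have "sym_tensor (d stress x)" using subspace_diff[OF subspace_sym_tensor] by auto
    then show ?case using elim by (intro compliance_nonneg)
  qed
qed

text \<open>
  The mass balance tested with both pressures, with the divergence term rewritten by Darcy's law.
\<close>

lemma mass_energy:
  "C * l2ip M (d pressure) (d pressure)
     + tstep P * (l2norm M (\<lambda>x. psd_sqrt (Kinv x) *v d flux x))\<^sup>2
     + l2ip M (d pporosity) (d pressure) = - (C / 3 * l2ip M b0 (d pressure))"
proof -
  let ?D = "\<lambda>x. wdiv (dom P) (flux s2) x - wdiv (dom P) (flux s1) x"
  have D: "L2 M ?D" by (intro L2_diff L2_wdiv)
  have "(l2norm M (\<lambda>x. psd_sqrt (Kinv x) *v d flux x))\<^sup>2 = l2ip M ?D (d pressure)"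
    using flux_energy darcy_change l2ip_commute[of M ?D "d pressure"] by simp
  moreover have "l2ip M f (d pressure) = l2ip M f (pressure s2) - l2ip M f (pressure s1)" if "L2 M f" for f
    by (rule l2ip_diff_right[OF L2_s2(1) L2_s1(1) that])
  note this[OF D] this[OF L2_d(1)] this[OF L2_d(5)] this[OF L2_b(2)]
  ultimately show ?thesis
    using mass_balance_change[OF W(1)] mass_balance_change[OF W(2)] 
    by (simp add: right_diff_distrib)
qed

lemma fcontent_energy:
  "(l2norm M (d fcontent))\<^sup>2
     = C\<^sup>2 * l2ip M (d pressure) (d pressure) + (C / 3)\<^sup>2 * l2ip M b b
       + l2ip M (d pporosity) (d pporosity) + 2 * C * (C / 3) * l2ip M b (d pressure)
       + 2 * C * l2ip M (d pporosity) (d pressure) + 2 * (C / 3) * l2ip M b (d pporosity)"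
proof -
  have L: "L2 M (\<lambda>x. C * d pressure x + (C / 3 * b x + d pporosity x))"
    using L2_add[OF L2_scaleR[OF L2_d(1), of C] L2_add[OF L2_scaleR[OF L2_b(1), of "C / 3"] L2_d(5)]]
    by simp
  have Lb: "L2 M (\<lambda>x. C / 3 * b x + d pporosity x)"
    using L2_add[OF L2_scaleR[OF L2_b(1), of "C / 3"] L2_d(5)] by simp
  have "(l2norm M (d fcontent))\<^sup>2 = l2ip M (\<lambda>x. C * d pressure x + (C / 3 * b x + d pporosity x))
          (\<lambda>x. C * d pressure x + (C / 3 * b x + d pporosity x))"
    unfolding l2norm_square using fcontent_change
    by (intro l2ip_cong_AE L2_d L) (auto simp: add.assoc)
  then show ?thesis
    using l2ip_lincomb_square[OF L2_d(1) Lb, of C 1] l2ip_lincomb_square[OF L2_b(1) L2_d(5), of "C / 3" 1]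
      l2ip_lincomb_left[OF L2_b(1) L2_d(5) L2_d(1), of "C / 3" 1]
      l2ip_commute[of M "d pressure" "\<lambda>x. C / 3 * b x + d pporosity x"]
    by (simp add: algebra_simps)
qed

lemma frozen_pressure_energy:
  "(l2norm M (\<lambda>x. dp fcontent x - dp pporosity x))\<^sup>2 = (C / 3)\<^sup>2 * l2ip M b b"
  "(l2norm M (\<lambda>x. biot P x \<bullet> dp estrain x))\<^sup>2 = (C / 3)\<^sup>2 * l2ip M b b"
proof -
  have Lb: "L2 M (\<lambda>x. C / 3 * b x)" using L2_scaleR[OF L2_b(1), of "C / 3"] by simp
  have sq: "l2ip M (\<lambda>x. C / 3 * b x) (\<lambda>x. C / 3 * b x) = (C / 3)\<^sup>2 * l2ip M b b"
    using l2ip_lincomb_square[OF L2_b(1) L2_b(1), of "C / 3" 0] by simp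
  have "(l2norm M f)\<^sup>2 = (C / 3)\<^sup>2 * l2ip M b b" if "L2 M f" "AE x in M. f x = C / 3 * b x" for f
    unfolding l2norm_square sq[symmetric] by (intro l2ip_cong_AE that Lb)
  note * = this
  show "(l2norm M (\<lambda>x. dp fcontent x - dp pporosity x))\<^sup>2 = (C / 3)\<^sup>2 * l2ip M b b"
    by (intro * mechanics_change L2_diff L2_s2 L2_h)
  show "(l2norm M (\<lambda>x. biot P x \<bullet> dp estrain x))\<^sup>2 = (C / 3)\<^sup>2 * l2ip M b b"
    by (intro * mechanics_change L2_bounded_inner fields L2_diff L2_s2 L2_h)
qed

lemma mechanics_fcontent_energy:
  "(l2norm M (\<lambda>x. biot P x \<bullet> dp estrain x + beta P x \<bullet> dp pstrain x))\<^sup>2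
     = (C / 3)\<^sup>2 * l2ip M b b + 2 * (C / 3) * l2ip M b (d pporosity)
       + l2ip M (d pporosity) (d pporosity)"
proof -
  have L: "L2 M (\<lambda>x. biot P x \<bullet> dp estrain x + beta P x \<bullet> dp pstrain x)"
    by (intro L2_add L2_bounded_inner fields L2_diff L2_s2 L2_h)
  have Lb: "L2 M (\<lambda>x. C / 3 * b x + d pporosity x)"
    using L2_add[OF L2_scaleR[OF L2_b(1), of "C / 3"] L2_d(5)] by simp
  have "AE x in M. biot P x \<bullet> dp estrain x + beta P x \<bullet> dp pstrain x = C / 3 * b x + d pporosity x"
    using mechanics_change(2,3) by eventually_elim simp
  then have "(l2norm M (\<lambda>x. biot P x \<bullet> dp estrain x + beta P x \<bullet> dp pstrain x))\<^sup>2
      = l2ip M (\<lambda>x. C / 3 * b x + d pporosity x) (\<lambda>x. C / 3 * b x + d pporosity x)"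
    unfolding l2norm_square by (intro l2ip_cong_AE L Lb)
  then show ?thesis
    using l2ip_lincomb_square[OF L2_b(1) L2_d(5), of "C / 3" 1] by simp
qed

text \<open>The negative term of the scheme, for an iteration that leads from \<open>s1\<close> via \<open>h\<close> to \<open>s2\<close>.\<close>

abbreviation "N \<equiv> 3 / C\<^sup>2 * (7/2 * (l2norm M (\<lambda>x. dp fcontent x - dp pporosity x))\<^sup>2
     + 1/2 * (l2norm M (d pporosity))\<^sup>2 + C / 3 * l2ip M b (d pporosity))"

text \<open>
  With \<open>X = C/3 b\<close>, both sides are \<open>3/(2 C\<^sup>2)\<close> times \<open>7 \<parallel>X\<parallel>\<^sup>2 + \<parallel>\<phi>\<parallel>\<^sup>2 + 2 (X, \<phi>)\<close>, on the right as
  \<open>6 \<parallel>X\<parallel>\<^sup>2 + \<parallel>X + \<phi>\<parallel>\<^sup>2\<close>.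
\<close>

lemma negative_term_eq_criterion:
  "N = 3 / (2 * C\<^sup>2) * (6 * (l2norm M (\<lambda>x. biot P x \<bullet> dp estrain x))\<^sup>2
     + (l2norm M (\<lambda>x. biot P x \<bullet> dp estrain x + beta P x \<bullet> dp pstrain x))\<^sup>2)"
  unfolding frozen_pressure_energy mechanics_fcontent_energy l2norm_square[of _ "d pporosity"]
  using pos(1) by (simp add: field_simps power2_eq_square)

text \<open>
  All terms are reduced to inner products of \<open>b\<close>, \<open>b0\<close>, \<open>d pressure\<close> and \<open>d pporosity\<close>, so that the
  cancellation becomes an identity between real numbers.
\<close>

lemma contraction:
  "(l2norm M b)\<^sup>2 + (l2norm M (d pressure))\<^sup>2
     + 3 / C * tstep P * (l2norm M (\<lambda>x. psd_sqrt (Kinv x) *v d flux x))\<^sup>2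
     + 3 / C * l2ip M (d stress) (\<lambda>x. compliance (elasticity P x) (d stress x))
     + 3 / (2 * C\<^sup>2) * (l2norm M (d fcontent))\<^sup>2 - N
   \<le> 1 / 2 * (l2norm M b0)\<^sup>2"
proof -
  \<comment> \<open>Names for the scalars keep the field arithmetic away from the integrals.\<close>
  define Z where "Z = tstep P * (l2norm M (\<lambda>x. psd_sqrt (Kinv x) *v d flux x))\<^sup>2"
  define p b' f pf bp b0p where "p = l2ip M (d pressure) (d pressure)"
    and "b' = l2ip M b b" and "f = l2ip M (d pporosity) (d pporosity)"
    and "pf = l2ip M (d pporosity) (d pressure)" and "bp = l2ip M b (d pressure)"
    and "b0p = l2ip M b0 (d pressure)"
  define bf where "bf = l2ip M b (d pporosity)"
  note defs = Z_def p_def b'_def f_def pf_def bp_def b0p_def bf_def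
  have mass: "Z = - (C / 3 * b0p) - C * p - pf"
    using mass_energy unfolding defs by linarith
  have "(l2norm M b)\<^sup>2 + (l2norm M (d pressure))\<^sup>2
     + 3 / C * tstep P * (l2norm M (\<lambda>x. psd_sqrt (Kinv x) *v d flux x))\<^sup>2
     + 3 / C * l2ip M (d stress) (\<lambda>x. compliance (elasticity P x) (d stress x))
     + 3 / (2 * C\<^sup>2) * (l2norm M (d fcontent))\<^sup>2 - N
   = b' + p + 3 / C * Z + 3 / C * - (C / 3 * bp)
     + 3 / (2 * C\<^sup>2) * (C\<^sup>2 * p + (C / 3)\<^sup>2 * b' + f + 2 * C * (C / 3) * bp + 2 * C * pf + 2 * (C / 3) * bf)
     - 3 / C\<^sup>2 * (7/2 * ((C / 3)\<^sup>2 * b') + 1/2 * f + C / 3 * bf)"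
    unfolding stress_energy fcontent_energy frozen_pressure_energy l2norm_square[of _ "d pporosity"]
      l2norm_square[of _ b] l2norm_square[of _ "d pressure"] defs by simp
  also have "\<dots> = - (1/2) * p - b0p"
    unfolding mass using pos(1) by (simp add: field_simps power2_eq_square)
  also have "\<dots> \<le> 1/2 * l2ip M b0 b0"
    using l2ip_young[OF L2_b(2) L2_d(1)] unfolding defs by simp
  finally show ?thesis by (simp add: l2norm_square)
qed

end

section \<open>The contraction estimate\<close>

theorem theorem1:
  fixes P :: poro_problem and sn :: poro_state and S H :: "nat \<Rightarrow> poro_state"
    and k :: nat and C \<Delta>t \<gamma> :: real
  assumes "wellposed_data P"
    and "fixed_stress_scheme P sn S H"
    and "1 \<le> k"
    and "C = hooke P" and "\<Delta>t = tstep P" and "\<gamma> = 1/2"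
  shows "(l2norm (leb P) (\<lambda>x. skempton P x \<bullet> diff S stress k x))\<^sup>2
         + (l2norm (leb P) (diff S pressure k))\<^sup>2
         + 3 / C * \<Delta>t *
             (l2norm (leb P) (\<lambda>x. psd_sqrt (matrix_inv (kappa P x)) *v diff S flux k x))\<^sup>2
         + 3 / C * l2ip (leb P) (diff S stress k)
             (\<lambda>x. compliance (elasticity P x) (diff S stress k x))
         + 3 / (2 * C\<^sup>2) * (l2norm (leb P) (diff S fcontent k))\<^sup>2
         - negative_term P S H k
         \<le> \<gamma> * (l2norm (leb P) (\<lambda>x. skempton P x \<bullet> diff S stress (k - 1) x))\<^sup>2
       \<and> 0 \<le> (l2norm (leb P) (diff S pressure k))\<^sup>2
       \<and> 0 \<le> 3 / C * \<Delta>t *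
             (l2norm (leb P) (\<lambda>x. psd_sqrt (matrix_inv (kappa P x)) *v diff S flux k x))\<^sup>2
       \<and> 0 \<le> 3 / C * l2ip (leb P) (diff S stress k)
             (\<lambda>x. compliance (elasticity P x) (diff S stress k x))
       \<and> 0 \<le> 3 / (2 * C\<^sup>2) * (l2norm (leb P) (diff S fcontent k))\<^sup>2
       \<and> negative_term P S H k = 3 / (2 * C\<^sup>2) * criterion_quantity P S H k
       \<and> (\<forall>TOL>0. criterion_quantity P S H k \<le> TOL \<longrightarrow> negative_term P S H k \<le> 3 / (2 * C\<^sup>2) * TOL)"
proof -
  obtain j where k: "k = Suc j" using assms(3) by (cases k) auto
  have it: "coupling_iteration P sn (S i) (H i) (S (Suc i))" for i
    using assms(2) by (simp add: fixed_stress_scheme_def)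
  \<comment> \<open>For \<open>i = 0\<close> this is the assumption on the initial guess.\<close>
  have "L2 (leb P) (stress (S i))" for i
    using assms(2) it[of "i - 1"]
    by (cases i) (auto simp: fixed_stress_scheme_def coupling_iteration_def square_integrable_state_def)
  then interpret consecutive_iterations P sn "S j" "H j" "S k" "H k" "S (Suc k)"
    using assms(1,2) it[of j] it[of k]
    by unfold_locales (auto simp: fixed_stress_scheme_def W_h_def k)
  have diffs: "diff S X k = (\<lambda>x. X (S (Suc k)) x - X (S k) x)"
    "diff_p S H X k = (\<lambda>x. X (S (Suc k)) x - X (H k) x)"
    "diff S X (k - 1) = (\<lambda>x. X (S k) x - X (S j) x)" for X :: "poro_state \<Rightarrow> real^3 \<Rightarrow> 'a::real_vector"
    by (auto simp: diff_def diff_p_def k)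
  have neg: "N = negative_term P S H k"
    unfolding negative_term_def diffs ..
  have crit: "negative_term P S H k = 3 / (2 * C\<^sup>2) * criterion_quantity P S H k"
    using negative_term_eq_criterion unfolding neg criterion_quantity_def diffs assms(4) .
  have "0 < C" "0 < \<Delta>t" using pos assms by auto
  then have "\<forall>TOL>0. criterion_quantity P S H k \<le> TOL \<longrightarrow> negative_term P S H k \<le> 3 / (2 * C\<^sup>2) * TOL"
    unfolding crit by (intro allI impI mult_left_mono) simp_all
  moreover have "0 \<le> 3 / C * l2ip (leb P) (diff S stress k)
             (\<lambda>x. compliance (elasticity P x) (diff S stress k x))"
    using stress_energy_nonneg \<open>0 < C\<close> unfolding diffs by simp
  ultimately show ?thesis
    using contraction[unfolded neg] crit \<open>0 < C\<close> \<open>0 < \<Delta>t\<close> unfolding diffs assms(4,5,6)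
    by (intro conjI) simp_all
qed

end
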